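(* Let $n \geq 3$ be an odd integer and $q = 3^n$. Then $|\mathrm{Solv}(\mathrm{PSL}(2, q))| = \frac{4q^2 - q + 1}{2}$.
   Context: For a finite group $G$ and $x \in G$, the solvabilizer of $x$ in $G$ is $\mathrm{Sol}_G(x) = \{y \in G : \langle x, y \rangle \text{ is solvable}\}$. $\mathrm{Solv}(G) = \{\mathrm{Sol}_G(x) : x \in G\}$ is the set of distinct solvabilizers of elements of $G$, and $|\mathrm{Solv}(G)|$ is its cardinality. *)

theory Defs
  imports "HOL-Algebra.Solvable_Groups" "HOL-Algebra.Generated_Groups" "HOL-Algebra.Coset"
begin

text \<open>2x2 matrices over a field, written as quadruples (a,b,c,d) for [[a,b],[c,d]].\<close>

definition SL2 :: "('a::field \<times> 'a \<times> 'a \<times> 'a) monoid" where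
  "SL2 = \<lparr> carrier = {(a,b,c,d). a*d - b*c = 1},
           mult = (\<lambda>(a,b,c,d) (e,f,g,h). (a*e + b*g, a*f + b*h, c*e + d*g, c*f + d*h)),
           one = (1,0,0,1) \<rparr>"

definition centre_SL2 :: "('a::field \<times> 'a \<times> 'a \<times> 'a) set" where
  "centre_SL2 = {(1,0,0,1), (-1,0,0,-1)}"

definition PSL2 :: "('a::field \<times> 'a \<times> 'a \<times> 'a) set monoid" where
  "PSL2 = SL2 Mod centre_SL2"

definition Sol :: "('g, 'b) monoid_scheme \<Rightarrow> 'g \<Rightarrow> 'g set" where
  "Sol G x = {y \<in> carrier G. solvable (G\<lparr>carrier := generate G {x, y}\<rparr>)}"

definition Solv :: "('g, 'b) monoid_scheme \<Rightarrow> 'g set set" where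
  "Solv G = Sol G ` carrier G"

end

theory Submission
  imports Defs "HOL-Number_Theory.Residues"
begin

text \<open>
  Over a field of characteristic 3, a matrix \<open>g\<close> of determinant 1 is \<open>X - t\<close> for its trace \<open>t\<close>
  and a trace-zero matrix \<open>X\<close> with \<open>det X = 1 - t\<^sup>2\<close>. The last nontrivial term of the derived series
  of a solvable subgroup is abelian, so either the subgroup preserves the line of some trace-zero
  matrix, or it permutes three mutually anticommuting involutions, and then every trace lies in the
  prime field. Conversely, the stabilizer of a line is metabelian.

  The solvabilizer of \<open>g\<close> therefore depends only on \<open>X\<close>, up to sign if \<open>X\<close> is nilpotent and up to
  scaling otherwise, and on whether \<open>t = 0\<close>. Every non-nilpotent \<open>X\<close> scales to determinant \<open>1\<close> or
  \<open>-1\<close>, so apart from the whole group there is one solvabilizer for each pair \<open>\<plusminus> X\<close> with \<open>X \<noteq> 0\<close>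
  nilpotent (unipotents), one for each pair with \<open>det X = -1\<close> (split tori), and two for each pair with \<open>det X = 1\<close> (the nonsplit torus and its
  involution). There are \<open>q\<^sup>2 - 1\<close>, \<open>q\<^sup>2 + q\<close> and \<open>q\<^sup>2 - q\<close> such \<open>X\<close>, respectively.
  As \<open>n\<close> is odd, \<open>-1\<close> is not a square, so there are no elements of order 4; the groups \<open>A\<^sub>4\<close> are
  exactly what separates the order-3 subgroups sharing a fixed point.
\<close>

subsection \<open>Solvability criteria\<close>

lemma (in group) commutator_in_derived:
  assumes "a \<in> H" and "b \<in> H"
  shows "a \<otimes> b \<otimes> inv a \<otimes> inv b \<in> derived G H"
  unfolding derived_def by (rule generate.incl) (use assms in blast)

text \<open>The witness is the last nontrivial term of the derived series, whose own derived
  subgroup is trivial.\<close>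

lemma (in group) solvable_imp_abelian_normal:
  assumes "solvable G" and "carrier G \<noteq> {\<one>}"
  obtains A where "A \<lhd> G" and "A \<noteq> {\<one>}" and "\<And>a b. a \<in> A \<Longrightarrow> b \<in> A \<Longrightarrow> a \<otimes> b = b \<otimes> a"
proof -
  let ?D = "\<lambda>n. (derived G ^^ n) (carrier G)"
  obtain n where "?D n = {\<one>}"
    using assms(1) solvable_iff_trivial_derived_seq by blast
  moreover define m where "m = (LEAST n. ?D n = {\<one>})"
  ultimately have m: "?D m = {\<one>}" and less: "\<And>k. k < m \<Longrightarrow> ?D k \<noteq> {\<one>}"
    using LeastI[of "\<lambda>n. ?D n = {\<one>}" n] not_less_Least[of _ "\<lambda>n. ?D n = {\<one>}"] by auto
  obtain k where k: "m = Suc k"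
    using m assms(2) by (cases m) auto
  have normal: "?D i \<lhd> G" for i
    by (induction i) (simp_all add: normal_self derived_is_normal)
  show thesis
  proof (rule that[of "?D k"])
    show "?D k \<lhd> G" "?D k \<noteq> {\<one>}"
      using normal less k by auto
    fix a b assume ab: "a \<in> ?D k" "b \<in> ?D k"
    have car: "a \<in> carrier G" "b \<in> carrier G"
      using subgroup.mem_carrier[OF normal_imp_subgroup[OF normal[of k]]] ab by blast+
    have "a \<otimes> b \<otimes> inv a \<otimes> inv b \<in> derived G (?D k)"
      using ab by (rule commutator_in_derived)
    hence "a \<otimes> b \<otimes> inv a \<otimes> inv b = \<one>"
      using m k by simp
    hence "a \<otimes> b \<otimes> inv (b \<otimes> a) = \<one>"
      using car by (simp add: inv_mult_group m_assoc)
    thus "a \<otimes> b = b \<otimes> a"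
      using car by (metis inv_closed inv_equality inv_inv m_closed)
  qed
qed

text \<open>The commutators put the derived subgroup of \<open>H\<close> inside the abelian
  \<open>A\<close>, so the second derived subgroup is trivial. \<open>A\<close> may reach outside
  \<open>H\<close>, which lets it be a full centralizer.\<close>

lemma (in group) metabelian_imp_solvable:
  assumes H: "subgroup H G" and A: "subgroup A G"
    and comm: "\<And>a b. a \<in> A \<Longrightarrow> b \<in> A \<Longrightarrow> a \<otimes> b = b \<otimes> a"
    and der: "\<And>g h. g \<in> H \<Longrightarrow> h \<in> H \<Longrightarrow> g \<otimes> h \<otimes> inv g \<otimes> inv h \<in> A"
  shows "solvable (G\<lparr>carrier := H\<rparr>)"
proof -
  interpret HG: group "G\<lparr>carrier := H\<rparr>"
    using H by (rule subgroup_imp_group)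
  let ?D = "derived G H"
  have D: "?D \<subseteq> A"
    unfolding derived_def by (rule generate_subgroup_incl[OF _ A]) (use der in blast)
  have DH: "?D \<subseteq> H"
    using derived_incl[OF order_refl H] .
  have "derived G ?D \<subseteq> {\<one>}"
    unfolding derived_def[of G ?D]
  proof (rule generate_subgroup_incl[OF _ triv_subgroup], safe)
    fix a b assume ab: "a \<in> ?D" "b \<in> ?D"
    then have car: "a \<in> carrier G" "b \<in> carrier G"
      using subgroup.mem_carrier[OF A] D by auto
    show "a \<otimes> b \<otimes> inv a \<otimes> inv b = \<one>"
      using comm[of a b] ab D car by (metis inv_closed m_assoc r_inv r_one subsetD)
  qed
  moreover have "\<one> \<in> derived G ?D"
    unfolding derived_def by (rule generate.one)
  ultimately have "derived G ?D = {\<one>}"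
    by blast
  hence "(derived (G\<lparr>carrier := H\<rparr>) ^^ 2) H = {\<one>}"
    using DH by (simp add: numeral_2_eq_2 derived_consistent[OF _ H])
  thus ?thesis
    using HG.solvable_iff_trivial_derived_seq by auto
qed

text \<open>Applied to \<open>A\<^sub>4\<close>, with \<open>A\<close> the Klein four-group.\<close>
lemma (in group) solvable_generate_abelian_by_order_three:
  assumes A: "subgroup A G" and comm: "\<And>a b. a \<in> A \<Longrightarrow> b \<in> A \<Longrightarrow> a \<otimes> b = b \<otimes> a"
    and u: "u \<in> carrier G" "u \<otimes> u \<otimes> u = \<one>" and norm: "\<And>a. a \<in> A \<Longrightarrow> u \<otimes> a \<otimes> inv u \<in> A"
    and y: "y \<in> A"
  shows "solvable (G\<lparr>carrier := generate G {u, y}\<rparr>)"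
proof (rule metabelian_imp_solvable[OF _ A comm])
  note Ac = subgroup.mem_carrier[OF A]
  have yc: "y \<in> carrier G" using y Ac by auto
  show "subgroup (generate G {u, y}) G"
    using u yc by (intro generate_is_subgroup) auto
  define cj where "cj k a = u [^] k \<otimes> a \<otimes> inv (u [^] k)" for k :: nat and a
  have cj: "cj k a \<in> A" if "a \<in> A" for k a
  proof (induction k)
    case 0 thus ?case using that Ac by (simp add: cj_def)
  next
    case (Suc k)
    have "cj (Suc k) a = u \<otimes> cj k a \<otimes> inv u"
      using u(1) Ac[OF that] unfolding cj_def
      by (simp only: nat_pow_Suc2) (simp add: inv_mult_group m_assoc)
    thus ?case using norm[OF Suc] by simp
  qed
  have cjmult: "u [^] k \<otimes> a = cj k a \<otimes> u [^] k" if "a \<in> A" for k a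
    using u(1) Ac[OF that] unfolding cj_def by (simp add: m_assoc)
  \<comment> \<open>Since \<open>inv u = u \<otimes> u\<close>, natural powers suffice for the
    normal form.\<close>
  have K: "\<exists>a\<in>A. \<exists>k::nat. h = a \<otimes> u [^] k" if "h \<in> generate G {u, y}" for h
    using that
  proof (induction rule: generate.induct)
    case one
    show ?case using subgroup.one_closed[OF A] by (intro bexI[of _ \<one>] exI[of _ 0]) auto
  next
    case (incl h)
    then consider "h = u" | "h = y" by blast
    thus ?case
    proof cases
      case 1 thus ?thesis using subgroup.one_closed[OF A] u(1)
        by (intro bexI[of _ \<one>] exI[of _ 1]) auto
    next
      case 2 thus ?thesis using y yc by (intro bexI[of _ y] exI[of _ 0]) auto
    qed
  next
    case (inv h)
    then consider "h = u" | "h = y" by blast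
    thus ?case
    proof cases
      case 1
      have "inv u = u \<otimes> u" using u by (metis inv_equality m_closed)
      thus ?thesis using 1 subgroup.one_closed[OF A] u(1)
        by (intro bexI[of _ \<one>] exI[of _ 2]) (auto simp: numeral_2_eq_2)
    next
      case 2 thus ?thesis using y yc subgroup.m_inv_closed[OF A]
        by (intro bexI[of _ "inv y"] exI[of _ 0]) auto
    qed
  next
    case (eng h1 h2)
    then obtain a b k l where ab: "a \<in> A" "b \<in> A" and h: "h1 = a \<otimes> u [^] (k::nat)" "h2 = b \<otimes> u [^] (l::nat)"
      by blast
    have "h1 \<otimes> h2 = a \<otimes> (u [^] k \<otimes> b) \<otimes> u [^] l"
      using ab Ac u(1) h by (simp add: m_assoc)
    also have "\<dots> = (a \<otimes> cj k b) \<otimes> u [^] (k + l)"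
      using ab Ac u(1) cj by (simp add: cjmult m_assoc nat_pow_mult)
    finally show ?case
      using ab cj subgroup.m_closed[OF A] by blast
  qed
  fix g h assume "g \<in> generate G {u, y}" "h \<in> generate G {u, y}"
  then obtain a b k l where ab: "a \<in> A" "b \<in> A" and gh: "g = a \<otimes> u [^] (k::nat)" "h = b \<otimes> u [^] (l::nat)"
    using K by metis
  have car: "a \<in> carrier G" "b \<in> carrier G" "u [^] k \<in> carrier G" "u [^] l \<in> carrier G"
    using ab Ac u by auto
  have uu: "u [^] k \<otimes> u [^] l \<otimes> inv (u [^] k) = u [^] l"
    using u(1) by (metis add.commute inv_solve_right' m_closed nat_pow_closed nat_pow_mult)
  \<comment> \<open>The powers of \<open>u\<close> cancel in the commutator and leave a product of
    four elements of \<open>A\<close>.\<close>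
  have "g \<otimes> h \<otimes> inv g \<otimes> inv h =
      a \<otimes> (u [^] k \<otimes> b) \<otimes> (u [^] l \<otimes> inv (u [^] k)) \<otimes> inv a \<otimes> inv (u [^] l) \<otimes> inv b"
    using car unfolding gh by (simp add: inv_mult_group m_assoc)
  also have "\<dots> = a \<otimes> cj k b \<otimes> (u [^] k \<otimes> u [^] l \<otimes> inv (u [^] k)) \<otimes> inv a \<otimes> inv (u [^] l) \<otimes> inv b"
    using car ab Ac[OF cj] by (simp add: cjmult m_assoc)
  also have "\<dots> = a \<otimes> cj k b \<otimes> cj l (inv a) \<otimes> inv b"
    unfolding uu using car ab Ac[OF cj] by (simp add: cj_def m_assoc)
  finally show "g \<otimes> h \<otimes> inv g \<otimes> inv h \<in> A"
    using ab cj subgroup.m_closed[OF A] subgroup.m_inv_closed[OF A] by simp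
qed

lemma (in group) generate_inv_left:
  assumes "x \<in> carrier G" "y \<in> carrier G"
  shows "generate G {inv x, y} = generate G {x, y}"
proof -
  have "generate G {inv x, y} \<subseteq> generate G {x, y}" if "x \<in> carrier G" for x
    using that assms(2)
    by (intro generate_subgroup_incl generate_is_subgroup) (auto intro: generate.intros)
  from this[OF assms(1)] this[OF inv_closed[OF assms(1)]] show ?thesis
    using assms(1) by auto
qed

subsection \<open>Two-by-two matrices\<close>

text \<open>A type of its own, unlike the quadruples of \<open>SL2\<close>, can carry matrix
  multiplication as an instance of \<open>ring_1\<close>.\<close>

datatype 'a m2 = M2 'a 'a 'a 'a

instantiation m2 :: (comm_ring_1) ring_1
begin

definition zero_m2 :: "'a m2" where "0 = M2 0 0 0 0"
definition one_m2 :: "'a m2" where "1 = M2 1 0 0 1"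
fun plus_m2 :: "'a m2 \<Rightarrow> 'a m2 \<Rightarrow> 'a m2" where
  "M2 a b c d + M2 e f g h = M2 (a + e) (b + f) (c + g) (d + h)"
fun minus_m2 :: "'a m2 \<Rightarrow> 'a m2 \<Rightarrow> 'a m2" where
  "M2 a b c d - M2 e f g h = M2 (a - e) (b - f) (c - g) (d - h)"
fun uminus_m2 :: "'a m2 \<Rightarrow> 'a m2" where
  "- M2 a b c d = M2 (- a) (- b) (- c) (- d)"
fun times_m2 :: "'a m2 \<Rightarrow> 'a m2 \<Rightarrow> 'a m2" where
  "M2 a b c d * M2 e f g h = M2 (a*e + b*g) (a*f + b*h) (c*e + d*g) (c*f + d*h)"

instance
proof
  fix x y z :: "'a m2"
  show "x * y * z = x * (y * z)" "(x + y) * z = x * z + y * z" "x * (y + z) = x * y + x * z"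
    by (cases x; cases y; cases z; simp add: algebra_simps)+
  show "x + y + z = x + (y + z)" "x + y = y + x" "0 + x = x" "- x + x = 0" "x - y = x + - y"
    "1 * x = x" "x * 1 = x" "(0::'a m2) \<noteq> 1"
    by (cases x; cases y; cases z; simp add: zero_m2_def one_m2_def)+
qed

end

definition sc :: "'a::comm_ring_1 \<Rightarrow> 'a m2" where "sc x = M2 x 0 0 x"
fun tr :: "'a::comm_ring_1 m2 \<Rightarrow> 'a" where "tr (M2 a b c d) = a + d"
fun det :: "'a::comm_ring_1 m2 \<Rightarrow> 'a" where "det (M2 a b c d) = a * d - b * c"

lemmas m2_defs = sc_def zero_m2_def one_m2_def

lemma sc_simps: "sc 0 = 0" "sc 1 = 1" "sc (- x) = - sc x" "sc (x + y) = sc x + sc y"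
  "sc (x - y) = sc x - sc y" "sc (x * y) = sc x * sc y"
  by (simp_all add: m2_defs)

lemma sc_eq_iff: "sc x = sc y \<longleftrightarrow> x = y"
  by (simp add: m2_defs)

lemma sc_commute: "g * sc x = sc x * g"
  by (cases g) (simp add: m2_defs mult.commute)

lemma sc_left_commute: "g * (sc x * h) = sc x * (g * h)"
  by (metis mult.assoc sc_commute)

lemma sc_mult_mult: "sc x * g * (sc y * h) = sc (x * y) * (g * h)"
  by (cases g; cases h) (simp add: m2_defs algebra_simps)

lemma tr_simps [simp]: "tr 0 = 0" "tr (- g) = - tr g" "tr (g + h) = tr g + tr h" "tr (g - h) = tr g - tr h"
  "tr (sc x) = x + x" "tr (sc x * g) = x * tr g" "tr 1 = 1 + 1"
  by (cases g; cases h; simp add: m2_defs algebra_simps)+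

lemma tr_commute: "tr (g * h) = tr (h * g)"
  by (cases g; cases h) (simp add: algebra_simps)

lemma det_simps [simp]: "det 0 = 0" "det 1 = 1" "det (sc x) = x * x" "det (- g) = det g"
  "det (g * h) = det g * det h"
  by (cases g; cases h; simp add: m2_defs algebra_simps)+

text \<open>The adjugate in its Cayley-Hamilton form; it inverts \<open>g\<close> when
  \<open>det g = 1\<close>.\<close>

definition adj :: "'a::comm_ring_1 m2 \<Rightarrow> 'a m2" where "adj g = sc (tr g) - g"

lemma mult_adj: "g * adj g = sc (det g)" "adj g * g = sc (det g)"
  by (cases g; simp add: adj_def m2_defs algebra_simps)+

lemma adj_simps [simp]: "adj 1 = 1" "adj (- g) = - adj g"
  by (cases g; simp add: adj_def m2_defs)+

lemma det_adj [simp]: "det (adj g) = det g" and tr_adj [simp]: "tr (adj g) = tr g"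
  by (cases g; simp add: adj_def m2_defs algebra_simps)+

section \<open>The quadratic form on trace-zero matrices\<close>

lemma det_sc_add: "tr X = 0 \<Longrightarrow> det (sc a + sc b * X) = a * a + b * b * det X"
  by (cases X) (simp add: m2_defs algebra_simps eq_neg_iff_add_eq_0[symmetric])

lemma trace0_square: "tr X = 0 \<Longrightarrow> X * X = - sc (det X)"
  by (cases X) (simp add: m2_defs algebra_simps eq_neg_iff_add_eq_0[symmetric])

text \<open>This is the polarization of \<open>trace0_square\<close>: up to sign,
  \<open>tr (X * Y)\<close> is the bilinear form of \<open>det\<close> on trace-zero matrices, and
  orthogonal means anticommuting.\<close>

lemma trace0_anticommutator: "tr X = 0 \<Longrightarrow> tr Y = 0 \<Longrightarrow> X * Y + Y * X = sc (tr (X * Y))"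
  by (cases X; cases Y) (simp add: m2_defs algebra_simps eq_neg_iff_add_eq_0[symmetric])

text \<open>The form \<open>tr (X * Y)\<close> on the three-dimensional space of trace-zero matrices
  is nondegenerate when 2 is invertible, so a totally isotropic subspace has dimension at most
  one.\<close>

lemma isotropic_orthogonal_imp_proportional:
  fixes X Y :: "'a::field m2"
  assumes "tr X = 0" "tr Y = 0" "det X = 0" "det Y = 0" "tr (X * Y) = 0" "Y \<noteq> 0" and two: "(2::'a) \<noteq> 0"
  shows "\<exists>c. X = sc c * Y"
proof -
  obtain a b c where X: "X = M2 a b c (- a)"
    using assms(1) by (cases X) (simp add: add_eq_0_iff)
  obtain x y z where Y: "Y = M2 x y z (- x)"
    using assms(2) by (cases Y) (simp add: add_eq_0_iff)
  have 1: "a * a + b * c = 0" "x * x + y * z = 0" "2 * (a * x) + b * z + c * y = 0"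
    using assms(3-5) X Y by (simp_all add: algebra_simps add_eq_0_iff)
  show ?thesis
  proof (cases "y = 0")
    case False
    have "(a * y - b * x)\<^sup>2 = y * y * (a * a + b * c) + b * b * (x * x + y * z)
        - b * y * (2 * (a * x) + b * z + c * y)"
      by (simp add: algebra_simps power2_eq_square)
    hence a: "a * y = b * x" using 1 by simp
    have "(c * y - b * z) * y = y * (2 * (a * x) + b * z + c * y) - 2 * b * (x * x + y * z)
        - 2 * x * (a * y - b * x)"
      by (simp add: algebra_simps)
    hence "(c * y - b * z) * y = 0"
      using 1 a by simp
    thus ?thesis
      using a False X Y by (intro exI[of _ "b / y"]) (simp add: m2_defs field_simps)
  next
    case True
    hence "x = 0" "z \<noteq> 0" using 1 assms(6) Y by (auto simp: m2_defs)
    moreover from this have "b = 0" "a = 0" using 1 True by auto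
    ultimately show ?thesis
      using True X Y by (intro exI[of _ "c / z"]) (simp add: m2_defs field_simps)
  qed
qed

text \<open>Up to factors of 2, the entries of \<open>X * Y - Y * X\<close> are the minors of the
  coordinate vectors of \<open>X\<close> and \<open>Y\<close>.\<close>

lemma commuting_trace0_imp_proportional:
  fixes X Y :: "'a::field m2"
  assumes "tr X = 0" "tr Y = 0" "X * Y = Y * X" "Y \<noteq> 0" and two: "(2::'a) \<noteq> 0"
  shows "\<exists>c. X = sc c * Y"
proof -
  obtain a b c where X: "X = M2 a b c (- a)"
    using assms(1) by (cases X) (simp add: add_eq_0_iff)
  obtain x y z where Y: "Y = M2 x y z (- x)"
    using assms(2) by (cases Y) (simp add: add_eq_0_iff)
  have e: "a * y + b * - x = x * b + y * - a" "c * x + - a * z = z * a + - x * c" "a * x + b * z = x * a + y * c"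
    using assms(3) unfolding X Y times_m2.simps m2.inject by blast+
  have "2 * (a * y - b * x) = (a * y + b * - x) - (x * b + y * - a)"
    "2 * (c * x - a * z) = (c * x + - a * z) - (z * a + - x * c)"
    by (simp_all add: algebra_simps)
  hence "2 * (a * y - b * x) = 0" "2 * (c * x - a * z) = 0"
    unfolding e by simp_all
  hence p: "b * z = c * y" "a * y = b * x" "a * z = c * x"
    unfolding mult_eq_0_iff using two e(3) by (auto simp: mult.commute)
  consider "x \<noteq> 0" | "y \<noteq> 0" | "z \<noteq> 0"
    using assms(4) Y by (auto simp: m2_defs)
  thus ?thesis
  proof cases
    case 1
    thus ?thesis using p X Y by (intro exI[of _ "a / x"]) (simp add: m2_defs field_simps)
  next
    case 2
    thus ?thesis using p X Y by (intro exI[of _ "b / y"]) (simp add: m2_defs field_simps)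
  next
    case 3
    thus ?thesis using p X Y by (intro exI[of _ "c / z"]) (simp add: m2_defs field_simps)
  qed
qed

subsection \<open>The group PSL(2)\<close>

fun tup :: "'a m2 \<Rightarrow> 'a \<times> 'a \<times> 'a \<times> 'a" where "tup (M2 a b c d) = (a, b, c, d)"

text \<open>This is the coset of \<open>g\<close> modulo the centre, spelled out so that equality in
  \<open>PSL2\<close> becomes equality of matrices up to sign.\<close>

definition proj :: "'a::comm_ring_1 m2 \<Rightarrow> ('a \<times> 'a \<times> 'a \<times> 'a) set" where
  "proj g = {tup g, tup (- g)}"

lemma tup_eq_iff: "tup g = tup h \<longleftrightarrow> g = h"
  by (cases g; cases h) simp

lemma carrier_SL2: "carrier (SL2 :: ('a::field \<times> 'a \<times> 'a \<times> 'a) monoid) = tup ` {g. det g = 1}"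
proof (intro subset_antisym subsetI)
  fix x :: "'a \<times> 'a \<times> 'a \<times> 'a" assume "x \<in> carrier SL2"
  then obtain a b c d where "x = tup (M2 a b c d)" "det (M2 a b c d) = 1"
    by (auto simp: SL2_def)
  thus "x \<in> tup ` {g. det g = 1}" by blast
next
  fix x :: "'a \<times> 'a \<times> 'a \<times> 'a" assume "x \<in> tup ` {g. det g = 1}"
  then obtain g where "x = tup g" "det g = 1" by blast
  thus "x \<in> carrier SL2" by (cases g) (simp add: SL2_def)
qed

lemma mult_SL2: "tup g \<otimes>\<^bsub>SL2\<^esub> tup h = tup (g * h)"
  by (cases g; cases h) (simp add: SL2_def)

lemma one_SL2: "\<one>\<^bsub>SL2\<^esub> = tup 1"
  by (simp add: SL2_def one_m2_def)

lemma group_SL2: "group (SL2 :: ('a::field \<times> 'a \<times> 'a \<times> 'a) monoid)"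
proof (rule groupI)
  fix x :: "'a \<times> 'a \<times> 'a \<times> 'a" assume "x \<in> carrier SL2"
  then obtain g where "x = tup g" "det g = 1" by (auto simp: carrier_SL2)
  thus "\<exists>y\<in>carrier SL2. y \<otimes>\<^bsub>SL2\<^esub> x = \<one>\<^bsub>SL2\<^esub>"
    by (intro bexI[of _ "tup (adj g)"])
      (auto simp: carrier_SL2 mult_SL2 one_SL2 mult_adj sc_simps intro!: imageI)
qed (auto simp: carrier_SL2 mult_SL2 one_SL2 mult.assoc)

lemma centre_SL2_eq: "centre_SL2 = proj 1"
  by (simp add: centre_SL2_def proj_def one_m2_def)

lemma inv_SL2: "det g = 1 \<Longrightarrow> inv\<^bsub>SL2\<^esub> tup g = tup (adj g :: 'a::field m2)"
  by (intro group.inv_equality[OF group_SL2])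
    (auto simp: carrier_SL2 mult_SL2 one_SL2 mult_adj sc_simps)

lemma normal_centre_SL2: "centre_SL2 \<lhd> (SL2 :: ('a::field \<times> 'a \<times> 'a \<times> 'a) monoid)"
proof -
  have "subgroup centre_SL2 (SL2 :: ('a \<times> 'a \<times> 'a \<times> 'a) monoid)"
    by (intro group.subgroupI[OF group_SL2])
      (auto simp: centre_SL2_eq proj_def carrier_SL2 mult_SL2 inv_SL2)
  moreover have "x \<otimes>\<^bsub>SL2\<^esub> z \<otimes>\<^bsub>SL2\<^esub> inv\<^bsub>SL2\<^esub> x \<in> centre_SL2"
    if "x \<in> carrier SL2" "z \<in> centre_SL2" for x z :: "'a \<times> 'a \<times> 'a \<times> 'a"
    using that by (auto simp: centre_SL2_eq proj_def carrier_SL2 mult_SL2 inv_SL2 mult_adj sc_simps)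
  ultimately show ?thesis
    by (simp add: group.normal_inv_iff[OF group_SL2])
qed

lemma group_PSL2: "group (PSL2 :: ('a::field \<times> 'a \<times> 'a \<times> 'a) set monoid)"
  unfolding PSL2_def by (rule normal.factorgroup_is_group[OF normal_centre_SL2])

lemma proj_eq_iff: "proj g = proj h \<longleftrightarrow> g = h \<or> g = - h"
  by (auto simp: proj_def doubleton_eq_iff tup_eq_iff)

lemma proj_minus [simp]: "proj (- g) = proj g"
  by (simp add: proj_eq_iff)

lemma carrier_PSL2: "carrier (PSL2 :: ('a::field \<times> 'a \<times> 'a \<times> 'a) set monoid) = proj ` {g. det g = 1}"
proof -
  have "centre_SL2 #>\<^bsub>SL2\<^esub> tup g = proj g" for g :: "'a m2"
    by (auto simp: r_coset_def centre_SL2_eq proj_def mult_SL2)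
  thus ?thesis
    by (auto simp: PSL2_def FactGroup_def RCOSETS_def carrier_SL2)
qed

lemma mult_PSL2: "proj g \<otimes>\<^bsub>PSL2\<^esub> proj h = proj (g * h)"
  by (auto simp: PSL2_def FactGroup_def set_mult_def proj_def mult_SL2)

lemma one_PSL2: "\<one>\<^bsub>PSL2\<^esub> = proj 1"
  by (simp add: PSL2_def FactGroup_def centre_SL2_eq)

lemma inv_PSL2: "det g = 1 \<Longrightarrow> inv\<^bsub>PSL2\<^esub> proj g = proj (adj g :: 'a::field m2)"
  by (intro group.inv_equality[OF group_PSL2])
    (auto simp: carrier_PSL2 mult_PSL2 one_PSL2 mult_adj sc_simps)

lemmas PSL2_simps = carrier_PSL2 mult_PSL2 one_PSL2 inv_PSL2

text \<open>Inverse-free form of: conjugation by \<open>g\<close> maps the line of \<open>Y\<close>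
  to itself.\<close>

definition pres :: "'a::comm_ring_1 m2 \<Rightarrow> 'a m2 \<Rightarrow> bool" where
  "pres g Y \<longleftrightarrow> (\<exists>l. g * Y = sc l * Y * g)"

text \<open>In characteristic 3, where \<open>1/2 = -1\<close>, this is the trace-zero part of \<open>g\<close>.\<close>
definition vec :: "'a::comm_ring_1 m2 \<Rightarrow> 'a m2" where
  "vec g = g + sc (tr g)"

lemma pres_scale:
  assumes "pres h Y" shows "pres h (sc c * Y)"
proof -
  obtain l where "h * Y = sc l * Y * h" using assms by (auto simp: pres_def)
  hence "h * (sc c * Y) = sc c * (sc l * Y * h)" by (metis sc_left_commute)
  also have "\<dots> = sc l * (sc c * Y) * h" by (cases Y; cases h) (simp add: m2_defs algebra_simps)
  finally show ?thesis by (auto simp: pres_def)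
qed

text \<open>For trace-zero \<open>X\<close> and determinant 1, these elements lie up to sign in the
  unipotent group, the split torus or the nonsplit torus belonging to \<open>X\<close>, according as
  \<open>det X\<close> is 0, -1 or 1.\<close>

definition tor :: "'a::comm_ring_1 \<Rightarrow> 'a \<Rightarrow> 'a m2 \<Rightarrow> 'a m2" where
  "tor a b X = sc a + sc b * X"

definition trace0_det :: "'a::comm_ring_1 \<Rightarrow> 'a m2 set" where
  "trace0_det e = {X. tr X = 0 \<and> det X = e}"

subsection \<open>Preserved lines\<close>

text \<open>These are the facts about a field with \<open>3 ^ n\<close> elements that the argument
  uses. Odd \<open>n\<close> gives \<open>nonsquare\<close> and \<open>square_or_minus\<close>;
  \<open>n > 1\<close> gives \<open>not_prime_field\<close>.\<close>

locale char3_field =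
  fixes ty :: "'a::{field,finite} itself"
  assumes three: "(3::'a) = 0"
    and nonsquare: "\<And>x::'a. x * x \<noteq> - 1"
    and square_or_minus: "\<And>x::'a. \<exists>s. x = s * s \<or> x = - (s * s)"
    and not_prime_field: "\<exists>m::'a. m \<noteq> 0 \<and> m \<noteq> 1 \<and> m \<noteq> - 1"
begin

lemma two: "(2::'a) = - 1"
proof -
  have "(2::'a) + 1 = 0" using three by simp
  thus ?thesis by (simp add: eq_neg_iff_add_eq_0)
qed

lemma four: "(4::'a) = 1"
proof -
  have "(4::'a) = 3 + 1" by simp
  thus ?thesis by (simp add: three)
qed

lemma two_neq_0: "(2::'a) \<noteq> 0" by (simp add: two)

lemma double: "(x::'a) + x = - x"
  using two by (metis mult_2 mult_minus1)

lemma eq_minus_iff_0: "(x::'a) = - x \<longleftrightarrow> x = 0" "- x = x \<longleftrightarrow> x = 0"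
  using double[of x] by (metis add_cancel_left_right neg_equal_0_iff_equal)+

lemma m2_double: "(g::'a m2) + g = - g"
  by (cases g) (simp add: double)

lemma tr_vec [simp]: "tr (vec (g::'a m2)) = 0"
  by (simp add: vec_def double)

lemma eq_vec: "(g::'a m2) = vec g - sc (tr g)"
  by (simp add: vec_def)

lemma det_vec: "det (vec (g::'a m2)) = det g - tr g * tr g"
proof -
  obtain a b c d where g: "g = M2 a b c d" by (cases g)
  have "det (vec g) = det g - tr g * tr g + 3 * (a + d) * (a + d)"
    by (simp add: g vec_def sc_def algebra_simps)
  thus ?thesis by (simp add: three)
qed

lemma vec_commute_iff: "vec (g::'a m2) * Y = Y * vec g \<longleftrightarrow> g * Y = Y * g"
  by (simp add: vec_def algebra_simps sc_commute)

lemma tr_vec_mult: "tr Y = 0 \<Longrightarrow> tr (vec (g::'a m2) * Y) = tr (g * Y)"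
  by (simp add: vec_def algebra_simps)

text \<open>Conjugation by \<open>b\<close> preserves the trace but turns \<open>a\<close> into
  \<open>- a\<close>.\<close>

lemma anticommuting_imp_tr_0:
  fixes a b :: "'a m2"
  assumes "a * b = - (b * a)" "det b = 1"
  shows "tr a = 0"
proof -
  have "tr (a * b * adj b) = - tr (b * a * adj b)"
    using assms(1) by simp
  also have "tr (b * a * adj b) = tr (adj b * b * a)"
    using tr_commute[of "b * a" "adj b"] by (simp add: mult.assoc)
  finally show ?thesis
    using assms(2) by (simp add: mult.assoc[of a] mult_adj sc_simps eq_minus_iff_0)
qed

text \<open>If \<open>det Y \<noteq> 0\<close>, comparing determinants leaves only the factors 1 and
  -1, that is, commuting or anticommuting. If \<open>Y\<close> is isotropic, \<open>g\<close> has to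
  fix the kernel of \<open>Y\<close>, a point of the projective line, which amounts to
  \<open>tr (g * Y) = 0\<close>.\<close>

lemma pres_iff:
  fixes g Y :: "'a m2"
  assumes Y: "tr Y = 0" "Y \<noteq> 0" and g: "det g = 1"
  shows "pres g Y \<longleftrightarrow> g * Y = Y * g \<or> tr (g * Y) = 0 \<and> (tr g = 0 \<or> det Y = 0)"
proof
  let ?X = "vec g" and ?t = "tr g"
  have ac: "?X * Y + Y * ?X = sc (tr (g * Y))"
    using trace0_anticommutator[OF tr_vec Y(1), of g] tr_vec_mult[OF Y(1)] by simp
  assume "pres g Y"
  then obtain l where l: "g * Y = sc l * Y * g" by (auto simp: pres_def)
  show "g * Y = Y * g \<or> tr (g * Y) = 0 \<and> (tr g = 0 \<or> det Y = 0)"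
  proof (cases "det Y = 0")
    case False
    have "det Y = l * l * det Y"
      using arg_cong[OF l, of det] g by simp
    hence "l = 1 \<or> l = - 1"
      using False by (simp add: square_eq_1_iff[symmetric] power2_eq_square)
    thus ?thesis
    proof
      assume "l = - 1"
      hence anti: "g * Y = - (Y * g)" using l by (simp add: sc_simps)
      hence "tr (g * Y) = - tr (g * Y)"
        by (metis tr_commute tr_simps(2))
      hence t0: "tr (g * Y) = 0" by (simp add: eq_minus_iff_0)
      have "sc ?t * Y = - (?X * Y + Y * ?X)"
        using anti m2_double[of "sc ?t * Y"] by (simp add: vec_def algebra_simps sc_commute)
      hence "sc ?t * Y = 0" using ac t0 by (simp add: sc_simps)
      hence "?t = 0" using Y(2) by (cases Y) (auto simp: m2_defs)
      thus ?thesis using t0 by simp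
    qed (use l in \<open>simp add: sc_simps\<close>)
  next
    case True
    hence YY: "Y * Y = 0" using trace0_square[OF Y(1)] by (simp add: sc_simps)
    have "Y * (g * Y) = sc l * (Y * Y) * g"
      unfolding l by (simp add: mult.assoc sc_left_commute)
    hence "Y * g * Y = 0" using YY by (simp add: mult.assoc)
    hence "Y * ?X * Y = 0"
      using YY by (simp add: vec_def algebra_simps sc_left_commute)
    hence "sc (tr (g * Y)) * Y = 0"
      using YY by (simp add: ac[symmetric] algebra_simps)
    hence "tr (g * Y) = 0" using Y(2) by (cases Y) (auto simp: m2_defs)
    thus ?thesis using True by simp
  qed
next
  assume "g * Y = Y * g \<or> tr (g * Y) = 0 \<and> (tr g = 0 \<or> det Y = 0)"
  then consider "g * Y = Y * g" | "tr (g * Y) = 0" "tr g = 0" | "tr (g * Y) = 0" "det Y = 0" by blast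
  thus "pres g Y"
  proof cases
    case 1 thus ?thesis by (auto simp: pres_def sc_simps intro!: exI[of _ 1])
  next
    case 2
    hence "g * Y + Y * g = 0" using trace0_anticommutator[of g Y] Y by (simp add: sc_simps)
    thus ?thesis by (auto simp: pres_def sc_simps eq_neg_iff_add_eq_0 intro!: exI[of _ "- 1"])
  next
    case 3
    \<comment> \<open>The conjugate \<open>?Z\<close> of \<open>Y\<close> is isotropic and, since
      \<open>?Z * Y = 0\<close>, orthogonal to \<open>Y\<close>; hence it lies on the line of
      \<open>Y\<close>.\<close>
    let ?Z = "g * Y * adj g"
    have gY: "g * Y * (g * Y) = 0" using trace0_square[OF 3(1)] 3 by (simp add: sc_simps)
    have YY: "Y * Y = 0" using trace0_square[OF Y(1)] 3 by (simp add: sc_simps)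
    have "?Z * Y = 0"
      using gY YY by (simp add: adj_def algebra_simps mult.assoc sc_left_commute)
    moreover have "tr ?Z = 0"
      using Y g by (simp add: tr_commute[of _ "adj g"] mult.assoc[symmetric] mult_adj sc_simps)
    ultimately obtain c where "?Z = sc c * Y"
      using isotropic_orthogonal_imp_proportional[of ?Z Y] 3 Y two_neq_0 by auto
    hence "?Z * g = sc c * Y * g" by simp
    thus ?thesis using g by (auto simp: mult.assoc mult_adj sc_simps pres_def)
  qed
qed

end

subsection \<open>Solvable two-generator subgroups\<close>

definition solv2 :: "'a::field m2 \<Rightarrow> 'a m2 \<Rightarrow> bool" where
  "solv2 g h \<longleftrightarrow> solvable (PSL2\<lparr>carrier := generate PSL2 {proj g, proj h}\<rparr>)"

lemma solv2_commute: "solv2 g h \<longleftrightarrow> solv2 h g"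
  by (simp add: solv2_def insert_commute)

lemma solv2_minus: "solv2 (- g) h \<longleftrightarrow> solv2 g h"
  by (simp add: solv2_def)

lemma solv2_adj:
  fixes g h :: "'a::field m2"
  assumes "det g = 1" "det h = 1"
  shows "solv2 (adj g) h \<longleftrightarrow> solv2 g h"
  using group.generate_inv_left[OF group_PSL2, of "proj g" "proj h"] assms
  by (auto simp: solv2_def inv_PSL2 carrier_PSL2)

lemma scaled_commute_mult:
  fixes g h Y :: "'a::comm_ring_1 m2"
  assumes "g * Y = sc l * Y * g" "h * Y = sc m * Y * h"
  shows "(g * h) * Y = sc (l * m) * Y * (g * h)"
proof -
  have "(g * h) * Y = sc m * (g * Y) * h"
    using assms(2) by (simp add: mult.assoc sc_left_commute)
  moreover have "sc (l * m) = sc m * sc l"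
    by (simp add: m2_defs)
  ultimately show ?thesis
    using assms(1) by (simp add: mult.assoc)
qed

lemma scaled_commute_adj:
  fixes g Y :: "'a::field m2"
  assumes "g * Y = sc l * Y * g" "det g = 1" "Y \<noteq> 0"
  shows "l \<noteq> 0" and "adj g * Y = sc (1 / l) * Y * adj g"
proof -
  have g: "adj g * g = 1" "g * adj g = 1" using assms(2) by (simp_all add: mult_adj sc_simps)
  show l: "l \<noteq> 0"
  proof
    assume "l = 0"
    hence "adj g * (g * Y) = 0" using assms(1) by (simp add: sc_simps)
    thus False using assms(3) g by (simp add: mult.assoc[symmetric])
  qed
  have "adj g * (g * Y) * adj g = adj g * (sc l * Y * g) * adj g"
    using assms(1) by simp
  hence "Y * adj g = sc l * (adj g * Y)"
    using g by (simp add: mult.assoc sc_left_commute) (simp add: mult.assoc[symmetric])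
  hence "sc (1 / l) * (Y * adj g) = sc (1 / l * l) * (adj g * Y)"
    by (simp only: sc_simps mult.assoc)
  thus "adj g * Y = sc (1 / l) * Y * adj g"
    using l by (simp add: sc_simps mult.assoc)
qed

lemma proj_subgroup:
  fixes P :: "'a::field m2 \<Rightarrow> bool"
  assumes "P 1" and "\<And>g h. det g = 1 \<Longrightarrow> det h = 1 \<Longrightarrow> P g \<Longrightarrow> P h \<Longrightarrow> P (g * h)"
    and "\<And>g. det g = 1 \<Longrightarrow> P g \<Longrightarrow> P (adj g)"
  shows "subgroup (proj ` {g. det g = 1 \<and> P g}) PSL2"
  by (intro group.subgroupI[OF group_PSL2])
    (use assms in \<open>auto simp: PSL2_simps intro!: imageI exI[of _ 1]\<close>)

lemma sc_mult_eq_0_iff: "sc (c::'a::field) * Y = 0 \<longleftrightarrow> c = 0 \<or> Y = 0"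
  by (cases Y) (auto simp: m2_defs)

text \<open>The factors in \<open>pres\<close> define a character of the stabilizer of the line, so
  commutators centralize \<open>Y\<close>. The centralizer is abelian because the trace-zero parts
  of its elements are multiples of \<open>Y\<close>.\<close>

lemma pres_imp_solv2:
  fixes g h Y :: "'a::{field,finite} m2"
  assumes "char3_field TYPE('a)"
    and g: "det g = 1" "pres g Y" and h: "det h = 1" "pres h Y" and Y: "tr Y = 0" "Y \<noteq> 0"
  shows "solv2 g h"
proof -
  interpret char3_field "TYPE('a)" by fact
  interpret P: group "PSL2 :: ('a \<times> 'a \<times> 'a \<times> 'a) set monoid" by (rule group_PSL2)
  let ?K = "proj ` {k. det k = 1 \<and> pres k Y}" and ?A = "proj ` {k. det k = 1 \<and> k * Y = Y * k}"
  have K: "subgroup ?K PSL2"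
  proof (rule proj_subgroup)
    show "pres 1 Y" unfolding pres_def by (rule exI[of _ 1]) (simp add: sc_simps)
    show "pres (g * h) Y" if "pres g Y" "pres h Y" for g h
      using that unfolding pres_def by (blast intro: scaled_commute_mult)
    show "pres (adj g) Y" if "pres g Y" "det g = 1" for g
      using that Y unfolding pres_def by (blast intro: scaled_commute_adj(2))
  qed
  have A: "subgroup ?A PSL2"
  proof (rule proj_subgroup)
    fix g h :: "'a m2" assume "g * Y = Y * g" "h * Y = Y * h"
    thus "g * h * Y = Y * (g * h)" by (metis mult.assoc)
    show "adj g * Y = Y * adj g"
      using \<open>g * Y = Y * g\<close> by (simp add: adj_def left_diff_distrib right_diff_distrib sc_commute)
  qed simp
  show ?thesis unfolding solv2_def
  proof (rule P.metabelian_imp_solvable[OF _ A])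
    show "subgroup (generate PSL2 {proj g, proj h}) PSL2"
      using g h by (intro P.generate_is_subgroup) (auto simp: PSL2_simps)
    fix a b assume "a \<in> ?A" "b \<in> ?A"
    then obtain k l where a: "a = proj k" "b = proj l" "k * Y = Y * k" "l * Y = Y * l" by blast
    obtain c d where "vec k = sc c * Y" "vec l = sc d * Y"
      using a Y vec_commute_iff commuting_trace0_imp_proportional[OF tr_vec Y(1) _ Y(2) two_neq_0] by metis
    moreover have "sc c * Y * (sc d * Y) = sc d * Y * (sc c * Y)"
      by (cases Y) (simp add: m2_defs algebra_simps)
    ultimately have "vec k * vec l = vec l * vec k"
      by simp
    hence "k * l = l * k"
      by (metis vec_commute_iff)
    thus "a \<otimes>\<^bsub>PSL2\<^esub> b = b \<otimes>\<^bsub>PSL2\<^esub> a"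
      using a by (simp add: mult_PSL2)
  next
    fix a b assume "a \<in> generate PSL2 {proj g, proj h}" "b \<in> generate PSL2 {proj g, proj h}"
    moreover have "generate PSL2 {proj g, proj h} \<subseteq> ?K"
      using g h by (intro P.generate_subgroup_incl[OF _ K]) auto
    ultimately obtain k l where kl: "a = proj k" "b = proj l" "det k = 1" "det l = 1" "pres k Y" "pres l Y"
      by blast
    then obtain r s where r: "k * Y = sc r * Y * k" and s: "l * Y = sc s * Y * l"
      by (auto simp: pres_def)
    let ?c = "k * l * adj k * adj l"
    have "?c * Y = sc (r * s * (1 / r) * (1 / s)) * Y * ?c"
      by (intro scaled_commute_mult scaled_commute_adj(2) r s kl Y)
    moreover have "r * s * (1 / r) * (1 / s) = 1"
      using scaled_commute_adj(1)[OF r kl(3) Y(2)] scaled_commute_adj(1)[OF s kl(4) Y(2)] by simp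
    ultimately have "?c * Y = Y * ?c"
      by (simp add: sc_simps(2))
    hence "proj ?c \<in> ?A"
      using kl by (intro imageI) simp
    moreover have "a \<otimes>\<^bsub>PSL2\<^esub> b \<otimes>\<^bsub>PSL2\<^esub> inv\<^bsub>PSL2\<^esub> a \<otimes>\<^bsub>PSL2\<^esub> inv\<^bsub>PSL2\<^esub> b = proj ?c"
      using kl by (simp add: PSL2_simps)
    ultimately show "a \<otimes>\<^bsub>PSL2\<^esub> b \<otimes>\<^bsub>PSL2\<^esub> inv\<^bsub>PSL2\<^esub> a \<otimes>\<^bsub>PSL2\<^esub> inv\<^bsub>PSL2\<^esub> b \<in> ?A"
      by simp
  qed
qed

context char3_field
begin

text \<open>The element \<open>1 + N\<close> has order 3 and permutes \<open>y\<close> and its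
  conjugates \<open>b\<close>, \<open>c\<close> cyclically. The condition
  \<open>tr (N * y) = 1\<close> makes these three anticommute, so modulo sign they form a Klein
  four-group with 1, and the generated group is \<open>A\<^sub>4\<close>.\<close>

lemma tetrahedral_imp_solv2:
  fixes N y :: "'a m2"
  assumes N: "tr N = 0" "det N = 0" and y: "tr y = 0" "det y = 1" and Ny: "tr (N * y) = 1"
  shows "solv2 (1 + N) y"
proof -
  interpret P: group "PSL2 :: ('a \<times> 'a \<times> 'a \<times> 'a) set monoid" by (rule group_PSL2)
  let ?u = "1 + N"
  have NN: "N * N = 0" and yy: "y * y = - 1"
    using trace0_square[OF N(1)] trace0_square[OF y(1)] N y by (simp_all add: sc_simps)
  have yN: "y * N = 1 - N * y"
    using trace0_anticommutator[OF N(1) y(1)] Ny by (simp add: sc_simps algebra_simps)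
  have assoc: "N * (N * x) = 0" "y * (y * x) = - x" "y * (N * x) = x - N * (y * x)" for x
    using NN yy yN by (simp_all add: mult.assoc[symmetric]) (simp add: algebra_simps)
  have "sc (1 + 1 :: 'a) = 1 + 1"
    by (simp only: sc_simps)
  hence u: "det ?u = 1" "adj ?u = 1 - N"
    using det_sc_add[OF N(1), of 1 1] N m2_double[of 1]
    by (simp_all add: sc_simps adj_def algebra_simps)
  \<comment> \<open>\<open>b\<close> and \<open>c\<close> are the conjugates of \<open>y\<close> by
    \<open>?u\<close> and its square, expanded with \<open>N * N = 0\<close> and
    \<open>y * N = 1 - N * y\<close>.\<close>
  define b where "b = y - N * y - 1 - N"
  define c where "c = y + N * y + 1 - N"
  have m2_triple: "x + (x + x) = 0" "x + (x + z) = z - x" for x z :: "'a m2"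
    using m2_double[of x] by (simp_all add: add.assoc[symmetric])
  \<comment> \<open>These rules move every \<open>N\<close> to the left of every \<open>y\<close>
    and reduce coefficients modulo 3, which decides the identities below by rewriting.\<close>
  note red = NN yy yN assoc algebra_simps m2_double m2_triple
  have mults: "y * b = c" "b * y = - c" "b * c = y" "c * b = - y" "c * y = b" "y * c = - b"
    "b * b = - 1" "c * c = - 1"
    by (simp_all add: b_def c_def red)
  have conj: "?u * y * (1 - N) = b" "?u * b * (1 - N) = c" "?u * c * (1 - N) = y"
    by (simp_all add: b_def c_def red)
  have tr0: "tr b = 0" "tr c = 0"
    using N y assms(5) by (simp_all add: b_def c_def two)
  have dets: "det b = 1" "det c = 1"
    using arg_cong[OF conj(1), of det] arg_cong[OF conj(2), of det] u det_adj[of ?u] y by simp_all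
  \<comment> \<open>Closure is checked on matrices, so both signs are listed: the eight matrices
    form a quaternion group.\<close>
  let ?A = "proj ` {k. det k = 1 \<and> (k = 1 \<or> k = y \<or> k = b \<or> k = c \<or> k = - 1 \<or> k = - y \<or> k = - b \<or> k = - c)}"
  have adjs: "adj y = - y" "adj b = - b" "adj c = - c"
    using tr0 y by (simp_all add: adj_def sc_simps)
  have A: "subgroup ?A PSL2"
    by (rule proj_subgroup) (auto simp: mults yy adjs)
  show ?thesis unfolding solv2_def
  proof (rule P.solvable_generate_abelian_by_order_three[OF A])
    show "proj ?u \<in> carrier PSL2" "proj y \<in> ?A"
      using u y by (auto simp: PSL2_simps)
    have "?u * ?u * ?u = 1"
      by (simp add: red)
    thus "proj ?u \<otimes>\<^bsub>PSL2\<^esub> proj ?u \<otimes>\<^bsub>PSL2\<^esub> proj ?u = \<one>\<^bsub>PSL2\<^esub>"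
      by (simp add: PSL2_simps)
  next
    fix a b assume "a \<in> ?A" "b \<in> ?A"
    thus "a \<otimes>\<^bsub>PSL2\<^esub> b = b \<otimes>\<^bsub>PSL2\<^esub> a"
      by (elim imageE CollectE conjE disjE; simp add: PSL2_simps mults)
  next
    fix a assume "a \<in> ?A"
    thus "proj ?u \<otimes>\<^bsub>PSL2\<^esub> a \<otimes>\<^bsub>PSL2\<^esub> inv\<^bsub>PSL2\<^esub> proj ?u \<in> ?A"
      using u dets y mult_adj(1)[of ?u]
      by (elim imageE CollectE conjE disjE; simp only: inv_PSL2 mult_PSL2 u conj mult_minus_right mult_minus_left proj_minus)
        (auto simp: sc_simps)
  qed
qed

lemma trace0_scale_eq:
  fixes X Y :: "'a m2"
  assumes "X = sc c * Y" "det X = det Y" "det Y \<noteq> 0"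
  shows "X = Y \<or> X = - Y"
proof -
  have "c * c = 1" using assms by simp
  hence "c = 1 \<or> c = - 1" by (simp add: square_eq_1_iff)
  thus ?thesis using assms(1) by (auto simp: sc_simps)
qed

text \<open>Let \<open>A\<close> be the preimage of a nontrivial abelian normal subgroup; its
  elements commute up to sign. A noncentral element of \<open>A\<close> with nonzero trace, or one
  that agrees up to sign with all its conjugates, yields a preserved line. Otherwise
  \<open>A\<close> contains an anticommuting pair, and averaging over the four-group of this pair
  forces every trace into the prime field.\<close>

lemma solvable_subgroup_cases:
  assumes H: "subgroup H PSL2"
    and solv: "solvable ((PSL2 :: ('a \<times> 'a \<times> 'a \<times> 'a) set monoid)\<lparr>carrier := H\<rparr>)"
  obtains Y :: "'a m2" where "tr Y = 0" "Y \<noteq> 0" "\<And>k. det k = 1 \<Longrightarrow> proj k \<in> H \<Longrightarrow> pres k Y"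
  | "\<And>k::'a m2. det k = 1 \<Longrightarrow> proj k \<in> H \<Longrightarrow> tr k = 0 \<or> tr k = 1 \<or> tr k = - 1"
proof (cases "H = {proj 1}")
  case True
  have "tr k = 0 \<or> tr k = 1 \<or> tr k = - 1" if "proj k \<in> H" for k :: "'a m2"
    using that True by (auto simp: proj_eq_iff two)
  thus ?thesis by (rule that(2))
next
  case False
  interpret P: group "PSL2 :: ('a \<times> 'a \<times> 'a \<times> 'a) set monoid" by (rule group_PSL2)
  interpret HG: group "(PSL2 :: ('a \<times> 'a \<times> 'a \<times> 'a) set monoid)\<lparr>carrier := H\<rparr>"
    using P.subgroup_imp_group[OF H] .
  from False obtain B where B: "B \<lhd> PSL2\<lparr>carrier := H\<rparr>" "B \<noteq> {proj 1}"
    and comm: "\<And>a b. a \<in> B \<Longrightarrow> b \<in> B \<Longrightarrow> a \<otimes>\<^bsub>PSL2\<^esub> b = b \<otimes>\<^bsub>PSL2\<^esub> a"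
    using HG.solvable_imp_abelian_normal[OF solv] by (auto simp: one_PSL2)
  have sub: "subgroup B (PSL2\<lparr>carrier := H\<rparr>)"
    using B(1) by (rule normal_imp_subgroup)
  have BH: "B \<subseteq> H" using subgroup.subset[OF sub] by simp
  have one: "proj 1 \<in> B" using subgroup.one_closed[OF sub] by (simp add: one_PSL2)
  define A where "A = {a :: 'a m2. det a = 1 \<and> proj a \<in> B}"
  have A_comm: "a * b = b * a \<or> a * b = - (b * a)" if "a \<in> A" "b \<in> A" for a b
    using comm[of "proj a" "proj b"] that by (simp add: A_def mult_PSL2 proj_eq_iff)
  have A_mult: "a * b \<in> A" if "a \<in> A" "b \<in> A" for a b
    using subgroup.m_closed[OF sub, of "proj a" "proj b"] that by (simp add: A_def mult_PSL2)
  have A_conj: "k * a * adj k \<in> A" if "a \<in> A" "det k = 1" "proj k \<in> H" for a k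
    using normal.inv_op_closed2[OF B(1), of "proj k" "proj a"] that
      P.m_inv_consistent[OF H that(3)] by (simp add: A_def mult_PSL2 inv_PSL2)
  obtain a where a: "a \<in> A" "a \<noteq> 1" "a \<noteq> - 1"
  proof -
    obtain x where x: "x \<in> B" "x \<noteq> proj 1" using B(2) one by blast
    moreover have "x \<in> carrier PSL2" using x BH subgroup.mem_carrier[OF H] by auto
    ultimately obtain a :: "'a m2" where "x = proj a" "det a = 1" by (auto simp: carrier_PSL2)
    thus thesis using that[of a] x by (auto simp: A_def proj_eq_iff)
  qed
  have conj_eq: "k * a = c * k" if "k * a * adj k = c" "det k = 1" for k a c :: "'a m2"
    using that by (auto simp: mult.assoc mult_adj sc_simps)
  show ?thesis
  proof (cases "\<exists>a\<in>A. a \<noteq> 1 \<and> a \<noteq> - 1 \<and> tr a \<noteq> 0")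
    case True
    then obtain a where a: "a \<in> A" "a \<noteq> 1" "a \<noteq> - 1" "tr a \<noteq> 0" by blast
    have vec_a: "vec a \<noteq> 0"
    proof
      assume "vec a = 0"
      then obtain t where t: "a = - sc t" using eq_vec[of a] by simp
      hence "t * t = 1" using a(1) by (simp add: A_def)
      hence "t = 1 \<or> t = - 1" by (simp add: square_eq_1_iff)
      thus False using a(2,3) t by (auto simp: sc_simps)
    qed
    have "pres k (vec a)" if k: "det k = 1" "proj k \<in> H" for k
    proof -
      let ?b = "k * a * adj k"
      have b: "?b \<in> A" using A_conj a k by blast
      \<comment> \<open>Anticommuting with \<open>?b\<close> would force \<open>tr a = 0\<close>, so
        \<open>a\<close> commutes with its conjugate.\<close>
      have "a * ?b = ?b * a"
        using A_comm[OF a(1) b] anticommuting_imp_tr_0[of a ?b] a(4) b by (auto simp: A_def)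
      hence "vec ?b * vec a = vec a * vec ?b" by (metis vec_commute_iff)
      then obtain c where c: "vec ?b = sc c * vec a"
        using commuting_trace0_imp_proportional[OF tr_vec tr_vec _ vec_a two_neq_0] by blast
      have "tr ?b = tr a"
        using tr_commute[of "k * a" "adj k"] k by (simp add: mult.assoc[symmetric] mult_adj sc_simps)
      moreover have "k * sc (tr a) * adj k = sc (tr a)"
        using k by (simp add: sc_commute mult.assoc mult_adj sc_simps)
      ultimately have "k * vec a * adj k = vec ?b"
        by (simp add: vec_def distrib_left distrib_right)
      hence "k * vec a = sc c * vec a * k"
        using c k conj_eq by metis
      thus ?thesis by (auto simp: pres_def)
    qed
    thus ?thesis using that(1)[of "vec a"] vec_a by simp
  next
    case False
    have tr0: "tr b = 0" if "b \<in> A" "b \<noteq> 1" "b \<noteq> - 1" for b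
      using False that by blast
    have deta: "det a = 1" using a by (simp add: A_def)
    have a0: "a \<noteq> 0" using deta by auto
    have pm: "b = a' \<or> b = - a'" if asm: "a' \<in> A" "b \<in> A" "tr a' = 0" "tr b = 0" "b * a' = a' * b" for a' b :: "'a m2"
    proof -
      have d: "det a' = 1" "det b = 1" using asm by (auto simp: A_def)
      hence "a' \<noteq> 0" by auto
      then obtain c where "b = sc c * a'"
        using commuting_trace0_imp_proportional[of b a'] asm two_neq_0 by blast
      thus ?thesis using trace0_scale_eq d by auto
    qed
    have conj_tr: "tr (k * b * adj k) = tr b" if "det k = 1" for k b :: "'a m2"
      using that tr_commute[of "k * b" "adj k"] by (simp add: mult.assoc[symmetric] mult_adj sc_simps)
    show ?thesis
    proof (cases "\<forall>k. det k = 1 \<longrightarrow> proj k \<in> H \<longrightarrow> k * a * adj k = a \<or> k * a * adj k = - a")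
      case True
      have "pres k a" if k: "det k = 1" "proj k \<in> H" for k
      proof -
        have "k * a = sc 1 * a * k \<or> k * a = sc (- 1) * a * k"
          using True k conj_eq[of k a] by (auto simp: sc_simps)
        thus ?thesis by (auto simp: pres_def)
      qed
      thus ?thesis using that(1)[of a] a0 tr0[OF a] by blast
    next
      case False
      then obtain k where k: "det k = 1" "proj k \<in> H" and ne: "k * a * adj k \<noteq> a" "k * a * adj k \<noteq> - a"
        by blast
      define b where "b = k * a * adj k"
      have tra: "tr a = 0" using tr0 a by blast
      have b: "b \<in> A" "tr b = 0" using A_conj a(1) k conj_tr tra by (auto simp: b_def)
      \<comment> \<open>Commuting trace-zero elements of \<open>A\<close> agree up to sign by
        \<open>pm\<close>. Hence \<open>a\<close> and its conjugate \<open>b\<close> anticommute,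
        and \<open>a\<close>, \<open>b\<close>, \<open>a * b\<close> multiply like quaternion
        units.\<close>
      have anti: "a * b = - (b * a)"
        using A_comm[OF a(1) b(1)] pm[OF a(1) b(1) tra b(2)] ne by (auto simp: b_def)
      define c where "c = a * b"
      have c: "c \<in> A" using A_mult a b by (simp add: c_def)
      have aa: "a * a = - 1" and bb: "b * b = - 1"
        using trace0_square[of a] trace0_square[of b] tra b deta by (auto simp: sc_simps A_def)
      have trc: "tr c = 0"
      proof -
        have "tr c = - tr c" using arg_cong[OF anti, of tr] by (simp add: c_def tr_commute[of b a])
        thus ?thesis by (simp add: eq_minus_iff_0)
      qed
      have "tr h = 0 \<or> tr h = 1 \<or> tr h = - 1" if h: "det h = 1" "proj h \<in> H" for h
      proof -
        \<comment> \<open>This sums the conjugates of \<open>h\<close> under 1, \<open>a\<close>,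
          \<open>b\<close>, \<open>c\<close>; the signs come from \<open>inverse = negative\<close>
          for the last three. As \<open>s\<close> commutes with \<open>a\<close> and
          \<open>b\<close>, it is scalar, and its trace is \<open>4 * tr h = tr h\<close>.\<close>
        define s where "s = h - a * h * a - b * h * b - c * h * c"
        have sq: "a * (a * x) = - x" "b * (b * x) = - x" "b * (a * x) = - (a * (b * x))" for x
          using aa bb anti by (simp_all add: mult.assoc[symmetric])
        have ba: "b * a = - (a * b)" using anti by simp
        have "a * s = s * a" "b * s = s * b"
          by (simp_all add: s_def c_def algebra_simps sq aa bb ba)
        hence "a * vec s = vec s * a" "b * vec s = vec s * b"
          using vec_commute_iff by metis+
        moreover obtain r where r: "vec s = sc r * a"
          using commuting_trace0_imp_proportional[OF tr_vec tra _ a0 two_neq_0, of s] calculation(1) by metis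
        ultimately have "sc r * (b * a) = sc r * (a * b)"
          by (simp add: sc_left_commute mult.assoc)
        hence "sc r * (a * b) = 0"
          using ba m2_double[of "sc r * (a * b)"] by simp
        hence "det (sc r * (a * b)) = 0" by simp
        hence "r = 0" using deta b by (simp add: A_def)
        hence s: "s = - sc (tr s)" using r eq_vec[of s] by (simp add: sc_simps)
        have cc: "c * c = - 1" by (simp add: c_def algebra_simps sq aa bb ba)
        have "tr (a * h * a) = - tr h" "tr (b * h * b) = - tr h" "tr (c * h * c) = - tr h"
          using aa bb cc by (simp_all add: tr_commute[of _ a] tr_commute[of _ b] tr_commute[of _ c] mult.assoc[symmetric])
        hence "tr s = tr h" using four by (simp add: s_def)
        hence "s * adj h = - (sc (tr h) * adj h)" using s by (metis mult_minus_left)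
        \<comment> \<open>Computing this trace in a second way, from the definition of
          \<open>s\<close>, expresses the square of \<open>tr h\<close> through the products of
          \<open>a\<close>, \<open>b\<close>, \<open>c\<close> with their conjugates by
          \<open>h\<close>.\<close>
        hence "tr (s * adj h) = - (tr h * tr h)" by simp
        moreover have "s * adj h = 1 - a * (h * a * adj h) - b * (h * b * adj h) - c * (h * c * adj h)"
          using h by (simp add: s_def algebra_simps mult_adj sc_simps)
        ultimately have eq: "tr h * tr h = 1 + tr (a * (h * a * adj h)) + tr (b * (h * b * adj h)) + tr (c * (h * c * adj h))"
          by (simp add: two algebra_simps)
        \<comment> \<open>Both \<open>d\<close> and its conjugate lie in \<open>A\<close>, so they
          either agree up to sign or are orthogonal.\<close>
        have F3: "tr (d * (h * d * adj h)) = 0 \<or> tr (d * (h * d * adj h)) = 1 \<or> tr (d * (h * d * adj h)) = - 1"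
          if d: "d \<in> A" "tr d = 0" for d
        proof -
          let ?e = "h * d * adj h"
          have e: "?e \<in> A" "tr ?e = 0" using A_conj d h conj_tr by auto
          have dd: "d * d = - 1" using trace0_square[of d] d by (auto simp: sc_simps A_def)
          show ?thesis
          proof (cases "?e * d = d * ?e")
            case True
            hence "?e = d \<or> ?e = - d" using pm d e by blast
            thus ?thesis using dd by (auto simp: two)
          next
            case False
            hence "d * ?e = - (?e * d)" using A_comm[OF d(1) e(1)] by auto
            hence "tr (d * ?e) = - tr (d * ?e)" using tr_commute tr_simps(2) by metis
            thus ?thesis by (simp add: eq_minus_iff_0)
          qed
        qed
        \<comment> \<open>The prime field is closed under addition; as -1 is not a square, only the
          values 0 and 1 survive.\<close>
        have "tr h * tr h = 0 \<or> tr h * tr h = 1 \<or> tr h * tr h = - 1"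
          unfolding eq using F3[OF a(1) tra] F3[OF b] F3[OF c trc] by (auto simp: two)
        thus ?thesis using nonsquare by (auto simp: square_eq_1_iff)
      qed
      thus ?thesis by (rule that(2))
    qed
  qed
qed

lemma solv2_cases:
  fixes g h :: "'a m2"
  assumes "solv2 g h" "det g = 1" "det h = 1"
  obtains Y where "tr Y = 0" "Y \<noteq> 0" "pres g Y" "pres h Y"
  | "\<And>k. k = g \<or> k = h \<or> k = g * h \<Longrightarrow> tr k = 0 \<or> tr k = 1 \<or> tr k = - 1"
proof -
  interpret P: group "PSL2 :: ('a \<times> 'a \<times> 'a \<times> 'a) set monoid" by (rule group_PSL2)
  let ?H = "generate PSL2 {proj g, proj h}"
  have H: "subgroup ?H PSL2"
    using assms by (intro P.generate_is_subgroup) (auto simp: carrier_PSL2)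
  have gh: "proj g \<in> ?H" "proj h \<in> ?H"
    by (auto intro: generate.incl)
  hence "proj (g * h) \<in> ?H"
    unfolding mult_PSL2[symmetric] by (rule generate.eng)
  with gh have mem: "proj k \<in> ?H \<and> det k = 1" if "k = g \<or> k = h \<or> k = g * h" for k
    using that assms by auto
  show thesis
    by (rule solvable_subgroup_cases[OF H assms(1)[unfolded solv2_def]]) (use that mem in blast)+
qed

text \<open>A trace outside the prime field rules out the second case of
  \<open>solv2_cases\<close>.\<close>

lemma solv2_generic_iff:
  fixes g h :: "'a m2"
  assumes "tr g \<noteq> 0" "tr g \<noteq> 1" "tr g \<noteq> - 1" and "det g = 1" "det h = 1"
  shows "solv2 g h \<longleftrightarrow> (\<exists>Y. tr Y = 0 \<and> Y \<noteq> 0 \<and> pres g Y \<and> pres h Y)"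
  using assms solv2_cases[of g h] pres_imp_solv2[OF char3_field_axioms] by metis

section \<open>Solvability with elements of tori\<close>

lemma vec_tor: "tr X = 0 \<Longrightarrow> vec (tor a b X :: 'a m2) = sc b * X"
  by (simp add: vec_def tor_def sc_simps two)

lemma tr_tor: "tr X = 0 \<Longrightarrow> tr (tor a b X :: 'a m2) = - a"
  by (simp add: tor_def double)

lemma tor_commute_iff: "b \<noteq> 0 \<Longrightarrow> tor a b X * Y = Y * tor a b X \<longleftrightarrow> X * Y = Y * (X :: 'a m2)"
proof -
  assume b: "b \<noteq> 0"
  have "tor a b X * Y = Y * tor a b X \<longleftrightarrow> sc b * (X * Y - Y * X) = 0"
    by (simp add: tor_def algebra_simps sc_left_commute sc_commute)
  thus ?thesis using b by (simp add: sc_mult_eq_0_iff)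
qed

text \<open>When its trace lies outside the prime field, \<open>g\<close> enters
  \<open>pres_iff\<close> only through the line of \<open>vec g\<close>. This allows passing to
  standard representatives in \<open>solvs_covering\<close>.\<close>

lemma solv2_proportional:
  fixes g g' h :: "'a m2"
  assumes g: "tr g \<noteq> 0" "tr g \<noteq> 1" "tr g \<noteq> - 1" "det g = 1"
    and g': "tr g' \<noteq> 0" "tr g' \<noteq> 1" "tr g' \<noteq> - 1" "det g' = 1"
    and h: "det h = 1" and c: "vec g' = sc c * vec g" "c \<noteq> 0"
  shows "solv2 g' h \<longleftrightarrow> solv2 g h"
proof -
  have "pres g' Y \<longleftrightarrow> pres g Y" if Y: "tr Y = 0" "Y \<noteq> 0" for Y
  proof -
    have "vec g' * Y = Y * vec g' \<longleftrightarrow> sc c * (vec g * Y - Y * vec g) = 0"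
      unfolding c by (simp add: mult.assoc sc_left_commute right_diff_distrib)
    hence "vec g' * Y = Y * vec g' \<longleftrightarrow> vec g * Y = Y * vec g"
      using c(2) by (simp add: sc_mult_eq_0_iff)
    moreover have "tr (vec g' * Y) = c * tr (vec g * Y)"
      unfolding c by (simp add: mult.assoc)
    ultimately show ?thesis
      using c(2) Y g g' by (simp add: pres_iff vec_commute_iff tr_vec_mult)
  qed
  thus ?thesis
    using assms by (simp add: solv2_generic_iff) blast
qed

text \<open>A nonsplit torus fixes no point of the projective line: otherwise \<open>Z\<close>
  multiplies \<open>Y\<close> by some \<open>m\<close>, and \<open>Z * Z = - 1\<close> gives
  \<open>m * m = - 1\<close>.\<close>

lemma isotropic_orthogonal_nonsplit:
  fixes Y Z :: "'a m2"
  assumes "tr Z = 0" "det Z = 1" "tr Y = 0" "det Y = 0" "tr (Z * Y) = 0"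
  shows "Y = 0"
proof (rule ccontr)
  assume "Y \<noteq> 0"
  have "Y * Y = 0" using trace0_square[OF assms(3)] assms(4) by (simp add: sc_simps)
  hence "tr (Z * Y * Y) = 0" by (simp add: mult.assoc)
  then obtain m where m: "Z * Y = sc m * Y"
    using isotropic_orthogonal_imp_proportional[of "Z * Y" Y] assms \<open>Y \<noteq> 0\<close> two_neq_0 by auto
  have "Z * Z = - 1" using trace0_square[OF assms(1)] assms(2) by (simp add: sc_simps)
  hence "- Y = Z * (Z * Y)" by (simp add: mult.assoc[symmetric])
  also have "\<dots> = Z * (sc m * Y)" by (simp only: m)
  also have "\<dots> = sc m * (Z * Y)" by (rule sc_left_commute)
  also have "\<dots> = sc (m * m) * Y" by (simp only: m sc_simps mult.assoc)
  finally have "sc (m * m) * Y + Y = 0" by (metis left_minus)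
  hence "sc (m * m + 1) * Y = 0" by (simp add: sc_simps distrib_right)
  hence "m * m = - 1" using \<open>Y \<noteq> 0\<close> by (simp add: sc_mult_eq_0_iff eq_neg_iff_add_eq_0)
  thus False using nonsquare by blast
qed

text \<open>The lines preserved by the torus element are that of \<open>Z\<close> and the isotropic
  lines orthogonal to \<open>Z\<close>. The conditions on \<open>h\<close> come from
  \<open>pres_iff\<close>; for isotropic \<open>Y\<close> they reduce to orthogonality, since
  commuting with \<open>Y\<close> makes \<open>vec h\<close> a multiple of \<open>Y\<close>.\<close>

lemma solv2_tor_iff:
  fixes h Z :: "'a m2"
  assumes ab: "a \<noteq> 0" "b \<noteq> 0" "a * a + b * b * det Z = 1" and Z: "tr Z = 0" "det Z \<noteq> 0" and h: "det h = 1"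
  shows "solv2 (tor a b Z) h \<longleftrightarrow> h * Z = Z * h \<or> tr h = 0 \<and> tr (h * Z) = 0 \<or>
     (\<exists>Y. Y \<noteq> 0 \<and> tr Y = 0 \<and> det Y = 0 \<and> tr (Z * Y) = 0 \<and> tr (h * Y) = 0)"
    (is "_ \<longleftrightarrow> ?R")
proof -
  let ?g = "tor a b Z"
  \<comment> \<open>The trace of \<open>?g\<close> is \<open>- a\<close>, so it lies outside the
    prime field.\<close>
  have "a * a \<noteq> 1" using ab Z by auto
  hence a: "- a \<noteq> 0" "- a \<noteq> 1" "- a \<noteq> - 1"
    using ab(1) by (simp, metis minus_mult_minus mult_1, auto)
  have g: "det ?g = 1" using ab det_sc_add[OF Z(1)] by (simp add: tor_def)
  have Z0: "Z \<noteq> 0" using Z by auto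
  have comm: "?g * Y = Y * ?g \<longleftrightarrow> Z * Y = Y * Z" for Y
    by (rule tor_commute_iff[OF ab(2)])
  have trg: "tr (?g * Y) = b * tr (Z * Y)" if "tr Y = 0" for Y
    using that by (simp add: tor_def distrib_right mult.assoc)
  have "solv2 ?g h \<longleftrightarrow> (\<exists>Y. tr Y = 0 \<and> Y \<noteq> 0 \<and> pres ?g Y \<and> pres h Y)"
    using a g h by (intro solv2_generic_iff) (simp_all add: tr_tor Z)
  also have "\<dots> \<longleftrightarrow> ?R"
  proof
    assume "\<exists>Y. tr Y = 0 \<and> Y \<noteq> 0 \<and> pres ?g Y \<and> pres h Y"
    then obtain Y where Y: "tr Y = 0" "Y \<noteq> 0" "pres ?g Y" "pres h Y" by blast
    from Y(3) consider "Z * Y = Y * Z" | "tr (Z * Y) = 0" "det Y = 0"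
      using a ab g Y(1,2) comm trg by (auto simp: pres_iff tr_tor Z)
    thus ?R
    proof cases
      case 1
      then obtain c where c: "Z = sc c * Y"
        using commuting_trace0_imp_proportional[of Z Y] Z Y two_neq_0 by auto
      have "pres h Z" unfolding c by (rule pres_scale) fact
      thus ?R using Z Z0 h by (auto simp: pres_iff)
    next
      case 2
      have "tr (h * Y) = 0"
      proof (cases "h * Y = Y * h")
        case True
        then obtain c where c: "vec h = sc c * Y"
          using commuting_trace0_imp_proportional[of "vec h" Y] Y two_neq_0 vec_commute_iff by auto
        have "tr (vec h * Y) = 0"
          using c trace0_square[of Y] Y 2 by (simp add: mult.assoc sc_simps)
        thus ?thesis using Y by (simp add: tr_vec_mult)
      qed (use Y h in \<open>auto simp: pres_iff\<close>)
      thus ?R using Y 2 by blast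
    qed
  next
    assume ?R
    then consider "h * Z = Z * h \<or> tr h = 0 \<and> tr (h * Z) = 0"
      | Y where "Y \<noteq> 0" "tr Y = 0" "det Y = 0" "tr (Z * Y) = 0" "tr (h * Y) = 0" by blast
    thus "\<exists>Y. tr Y = 0 \<and> Y \<noteq> 0 \<and> pres ?g Y \<and> pres h Y"
    proof cases
      case 1
      thus ?thesis using Z Z0 h g comm[of Z] by (intro exI[of _ Z]) (auto simp: pres_iff)
    next
      case 2
      thus ?thesis using h g trg by (intro exI[of _ Y]) (auto simp: pres_iff)
    qed
  qed
  finally show ?thesis .
qed

lemma trace0_det_scale_eq:
  assumes "X \<in> trace0_det e" "Y \<in> trace0_det e" "e \<noteq> 0" "X * Y = Y * (X::'a m2)"
  shows "X = Y \<or> X = - Y"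
proof -
  have "Y \<noteq> 0" using assms by (auto simp: trace0_det_def)
  then obtain c where "X = sc c * Y"
    using commuting_trace0_imp_proportional[of X Y] assms two_neq_0 by (auto simp: trace0_det_def)
  thus ?thesis using trace0_scale_eq assms by (auto simp: trace0_det_def)
qed

lemma exists_split_params: "\<exists>a b::'a. a \<noteq> 0 \<and> b \<noteq> 0 \<and> a * a - b * b = 1"
proof -
  obtain m :: 'a where m: "m \<noteq> 0" "m \<noteq> 1" "m \<noteq> - 1" using not_prime_field by blast
  have "m * m \<noteq> 1" "m * m \<noteq> - 1" using m nonsquare by (auto simp: square_eq_1_iff)
  hence "m + 1 / m \<noteq> 0" "m - 1 / m \<noteq> 0" using m by (auto simp: field_simps eq_neg_iff_add_eq_0)
  moreover have "(m + 1 / m) * (m + 1 / m) - (m - 1 / m) * (m - 1 / m) = 4"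
    using m by (simp add: field_simps)
  ultimately show ?thesis using four by metis
qed

lemma exists_nonsplit_params: "\<exists>a b::'a. a \<noteq> 0 \<and> b \<noteq> 0 \<and> a * a + b * b = 1"
proof -
  obtain m :: 'a where m: "m \<noteq> 0" "m \<noteq> 1" "m \<noteq> - 1" using not_prime_field by blast
  have mm: "m * m \<noteq> 1" "m * m \<noteq> - 1" using m nonsquare by (auto simp: square_eq_1_iff)
  hence n: "1 + m * m \<noteq> 0" by (auto simp: eq_neg_iff_add_eq_0 add.commute)
  \<comment> \<open>This is the rational parametrization of the unit circle.\<close>
  let ?a = "2 * m / (1 + m * m)" and ?b = "(1 - m * m) / (1 + m * m)"
  have "?a * ?a + ?b * ?b = (2 * m * (2 * m) + (1 - m * m) * (1 - m * m)) / ((1 + m * m) * (1 + m * m))"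
    by (simp add: add_divide_distrib)
  also have "2 * m * (2 * m) + (1 - m * m) * (1 - m * m) = (1 + m * m) * (1 + m * m)"
    by (simp add: algebra_simps)
  finally have "?a * ?a + ?b * ?b = 1" using n by simp
  moreover have "?a \<noteq> 0" "?b \<noteq> 0" using n m mm two_neq_0 by auto
  ultimately show ?thesis by blast
qed

end

subsection \<open>Separating solvabilizers\<close>

text \<open>
  The parameters make \<open>tor p r X\<close> (for \<open>det X = -1\<close>) and \<open>tor u v X\<close> (for \<open>det X = 1\<close>) elements of
  determinant 1 with trace outside the prime field, so that solvability with them forces a common
  preserved line.
\<close>
locale char3_tori = char3_field ty for ty :: "'a::{field,finite} itself" +
  fixes p r u v :: 'a
  assumes split_params: "p \<noteq> 0" "r \<noteq> 0" "p * p - r * r = 1"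
    and nonsplit_params: "u \<noteq> 0" "v \<noteq> 0" "u * u + v * v = 1"
begin

abbreviation "nilp \<equiv> trace0_det (0::'a) - {0}"
abbreviation "spl \<equiv> trace0_det (- 1 :: 'a)"
abbreviation "inv2 \<equiv> trace0_det (1::'a)"

text \<open>The preimage of the solvabilizer of \<open>proj g\<close> among matrices, where all
  comparisons take place; \<open>card_Solv\<close> transfers the count.\<close>

definition solvs :: "'a m2 \<Rightarrow> 'a m2 set" where
  "solvs g = {h. det h = 1 \<and> solv2 g h}"

lemma det_tor:
  "N \<in> nilp \<Longrightarrow> det (tor 1 1 N) = 1" "X \<in> spl \<Longrightarrow> det (tor p r X) = 1" "X \<in> inv2 \<Longrightarrow> det (tor u v X) = 1"
  using split_params nonsplit_params by (auto simp: trace0_det_def tor_def det_sc_add)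

lemma solvs_eqD: "solvs g = solvs g' \<Longrightarrow> det h = 1 \<Longrightarrow> solv2 g h \<longleftrightarrow> solv2 g' h"
  by (auto simp: solvs_def)

text \<open>The isotropic alternative of \<open>solv2_tor_iff\<close> is excluded by
  \<open>isotropic_orthogonal_nonsplit\<close>.\<close>

lemma solv2_nonsplit_iff:
  assumes "Z \<in> inv2" "det h = 1"
  shows "solv2 h (tor u v Z) \<longleftrightarrow> h * Z = Z * h \<or> tr h = 0 \<and> tr (h * Z) = 0"
proof -
  have Z: "tr Z = 0" "det Z = 1" using assms by (auto simp: trace0_det_def)
  show ?thesis
    unfolding solv2_commute[of h]
    using solv2_tor_iff[OF nonsplit_params(1,2) _ Z(1) _ assms(2)] Z nonsplit_params(3)
      isotropic_orthogonal_nonsplit[OF Z] by force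
qed

lemma solv2_split_iff:
  assumes "Z \<in> spl" "det h = 1"
  shows "solv2 h (tor p r Z) \<longleftrightarrow> h * Z = Z * h \<or> tr h = 0 \<and> tr (h * Z) = 0 \<or>
     (\<exists>Y. Y \<noteq> 0 \<and> tr Y = 0 \<and> det Y = 0 \<and> tr (Z * Y) = 0 \<and> tr (h * Y) = 0)"
  unfolding solv2_commute[of h]
  by (rule solv2_tor_iff) (use assms split_params in \<open>auto simp: trace0_det_def\<close>)

lemma commuting_imp_same_line:
  assumes "X \<in> trace0_det e" "Y \<in> trace0_det d" "X * Y = Y * (X :: 'a m2)" "Y \<noteq> 0"
  obtains c where "X = sc c * Y" "e = c * c * d"
proof -
  obtain c where "X = sc c * Y"
    using commuting_trace0_imp_proportional[of X Y] assms two_neq_0 by (auto simp: trace0_det_def)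
  moreover from this have "e = c * c * d" using assms by (auto simp: trace0_det_def)
  ultimately show thesis by (rule that)
qed

section \<open>Testing solvabilizers against nonsplit tori\<close>

lemma solv2_tor_nonsplit_iff:
  assumes "tr X = 0" "a \<noteq> 0" "b \<noteq> 0" "det (tor a b X) = 1" "Z \<in> inv2"
  shows "solv2 (tor a b X) (tor u v Z) \<longleftrightarrow> X * Z = Z * X"
  using assms by (simp add: solv2_nonsplit_iff tr_tor tor_commute_iff)

lemma inv2_commute_iff:
  assumes "X \<in> inv2" "Z \<in> inv2"
  shows "X * Z = Z * X \<longleftrightarrow> Z = X \<or> Z = - X"
proof
  assume "X * Z = Z * X"
  thus "Z = X \<or> Z = - X" by (intro trace0_det_scale_eq[OF assms(2,1)]) simp_all
qed auto

text \<open>An invariant of \<open>solvs g\<close>. It is everything for the identity, empty for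
  unipotent and split elements, one pair for nonsplit ones, and a pair together with its orthogonal
  complement in \<open>inv2\<close> for involutions.\<close>

definition nonsplit_tests :: "'a m2 \<Rightarrow> 'a m2 set" where
  "nonsplit_tests g = {Z \<in> inv2. solv2 g (tor u v Z)}"

lemma nonsplit_tests_cong: "solvs g = solvs g' \<Longrightarrow> nonsplit_tests g = nonsplit_tests g'"
  using solvs_eqD[of g g'] det_tor by (auto simp: nonsplit_tests_def)

lemma inv2_neq_0: "X \<in> inv2 \<Longrightarrow> X \<noteq> 0" and spl_neq_0: "X \<in> spl \<Longrightarrow> X \<noteq> 0"
  by (auto simp: trace0_det_def)

lemma nonsplit_tests_one: "nonsplit_tests 1 = inv2"
  by (auto simp: nonsplit_tests_def solv2_nonsplit_iff)

lemma nonsplit_tests_unipotent: "nonsplit_tests (tor 1 1 N) = {}" if N: "N \<in> nilp"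
proof -
  have False if Z: "Z \<in> inv2" "solv2 (tor 1 1 N) (tor u v Z)" for Z
  proof -
    have "N * Z = Z * N"
      using solv2_tor_nonsplit_iff[OF _ _ _ det_tor(1)[OF N] Z(1)] Z(2) N by (simp add: trace0_det_def)
    then obtain c where "N = sc c * Z" "0 = c * c * 1"
      using commuting_imp_same_line[of N 0 Z 1] N Z inv2_neq_0 by blast
    thus False using N by (simp add: sc_simps)
  qed
  thus ?thesis by (auto simp: nonsplit_tests_def)
qed

lemma nonsplit_tests_split: "nonsplit_tests (tor p r X) = {}" if X: "X \<in> spl"
proof -
  have False if Z: "Z \<in> inv2" "solv2 (tor p r X) (tor u v Z)" for Z
  proof -
    have "X * Z = Z * X"
      using solv2_tor_nonsplit_iff[OF _ _ _ det_tor(2)[OF X] Z(1)] Z(2) X split_params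
      by (simp add: trace0_det_def)
    then obtain c where "X = sc c * Z" "- 1 = c * c * 1"
      by (rule commuting_imp_same_line[OF X Z(1) _ inv2_neq_0[OF Z(1)]])
    thus False using nonsquare[of c] by simp
  qed
  thus ?thesis by (auto simp: nonsplit_tests_def)
qed

lemma nonsplit_tests_nonsplit: "nonsplit_tests (tor u v X) = {X, - X}" if X: "X \<in> inv2"
proof -
  have "solv2 (tor u v X) (tor u v Z) \<longleftrightarrow> X * Z = Z * X" if "Z \<in> inv2" for Z
    using solv2_tor_nonsplit_iff[OF _ _ _ det_tor(3)[OF X] that] X nonsplit_params
    by (simp add: trace0_det_def)
  thus ?thesis
    using X inv2_commute_iff[OF X] by (auto simp: nonsplit_tests_def) (auto simp: trace0_det_def)
qed

lemma nonsplit_tests_involution: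
  "nonsplit_tests X = {X, - X} \<union> {Z \<in> inv2. tr (X * Z) = 0}" if X: "X \<in> inv2"
proof -
  have "solv2 X (tor u v Z) \<longleftrightarrow> X * Z = Z * X \<or> tr (X * Z) = 0" if "Z \<in> inv2" for Z
    using that X by (auto simp: solv2_nonsplit_iff trace0_det_def)
  thus ?thesis
    using X inv2_commute_iff[OF X] by (auto simp: nonsplit_tests_def) (auto simp: trace0_det_def)
qed

lemma inv2_square: "X \<in> inv2 \<Longrightarrow> X * X = - 1"
  using trace0_square[of X] by (auto simp: trace0_det_def sc_simps)

lemma tr_inv2_square: "X \<in> inv2 \<Longrightarrow> tr (X * X) = 1"
  by (simp add: inv2_square two)

text \<open>A matrix \<open>W\<close> orthogonal to \<open>X\<close> is scaled to determinant 1. If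
  \<open>det W\<close> is minus a square, multiplication by \<open>1 + X\<close> first corrects
  this: it keeps orthogonality to \<open>X\<close> and multiplies the determinant by
  \<open>2 = - 1\<close>.\<close>

lemma exists_orthogonal:
  assumes "X \<in> inv2" obtains Z where "Z \<in> inv2" "tr (X * Z) = 0"
proof -
  obtain a b c where X: "X = M2 a b c (- a)"
    using assms by (cases X) (auto simp: trace0_det_def add_eq_0_iff)
  have bc: "b * c \<noteq> 0"
  proof
    assume "b * c = 0"
    hence "- (a * a) = 1" using assms unfolding X trace0_det_def by auto
    thus False using nonsquare[of a] by (metis add.inverse_inverse)
  qed
  define W where "W = M2 0 b (- c) 0"
  have W: "tr W = 0" "det W = b * c" "tr (X * W) = 0"
    by (simp_all add: W_def X)
  have XX: "X * X = - 1" using inv2_square assms by blast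
  have WX: "tr ((1 + X) * W) = 0" "tr (X * ((1 + X) * W)) = 0" "det ((1 + X) * W) = - (b * c)"
  proof -
    show "tr ((1 + X) * W) = 0" using W by (simp add: distrib_right)
    have "X * ((1 + X) * W) = X * W + X * X * W" by (simp add: algebra_simps)
    thus "tr (X * ((1 + X) * W)) = 0" using W XX by simp
    have "det (1 + X) = 2"
      using det_sc_add[of X 1 1] assms by (simp add: trace0_det_def sc_simps)
    thus "det ((1 + X) * W) = - (b * c)" using W two by simp
  qed
  obtain s where s: "b * c = s * s \<or> b * c = - (s * s)" using square_or_minus by blast
  have sn: "s \<noteq> 0" using s bc by auto
  from s show thesis
  proof
    assume "b * c = s * s"
    thus thesis using W sn
      by (intro that[of "sc (1 / s) * W"]) (simp_all add: trace0_det_def sc_left_commute)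
  next
    assume "b * c = - (s * s)"
    thus thesis using WX sn
      by (intro that[of "sc (1 / s) * ((1 + X) * W)"]) (simp_all add: trace0_det_def sc_left_commute del: det_simps(5), simp_all)
  qed
qed

text \<open>\<open>W = (u + v X) X'\<close> rotates \<open>X'\<close> within the plane orthogonal to
  \<open>X\<close>. As \<open>u\<close> and \<open>v\<close> are nonzero, it is neither orthogonal
  to \<open>X'\<close> nor equal to it up to sign.\<close>

lemma orthogonal_pair_rotation:
  assumes X: "X \<in> inv2" "X' \<in> inv2" "tr (X * X') = 0"
  obtains W where "W \<in> inv2" "tr (X * W) = 0" "tr (X' * W) \<noteq> 0" "W \<noteq> X'" "W \<noteq> - X'"
proof
  have sq: "X * X = - 1" "X' * X' = - 1" "X' * (X * X') = X"
  proof -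
    show sq: "X * X = - 1" "X' * X' = - 1" using X inv2_square by auto
    have "X * X' + X' * X = 0"
      using trace0_anticommutator[of X X'] X by (auto simp: trace0_det_def sc_simps)
    hence "X * X' = - (X' * X)" by (simp add: eq_neg_iff_add_eq_0)
    hence "X' * (X * X') = - (X' * X') * X" by (simp add: mult.assoc)
    thus "X' * (X * X') = X" using sq by simp
  qed
  let ?W = "sc u * X' + sc v * (X * X')"
  have tr0: "tr X = 0" "tr X' = 0" using X by (auto simp: trace0_det_def)
  have "?W = (sc u + sc v * X) * X'" by (simp add: algebra_simps)
  moreover have "det (sc u + sc v * X) = 1"
    using X nonsplit_params by (simp add: det_sc_add trace0_det_def)
  ultimately have "det ?W = 1" using X by (simp add: trace0_det_def)
  thus "?W \<in> inv2" using X tr0 by (simp add: trace0_det_def)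
  have XW: "X * ?W = sc u * (X * X') - sc v * X'"
    by (simp add: distrib_left sc_left_commute) (simp add: mult.assoc[symmetric] sq)
  thus "tr (X * ?W) = 0" using X tr0 by (simp add: trace0_det_def)
  have X'W: "X' * ?W = sc v * X - sc u"
    using sq by (simp add: distrib_left sc_left_commute)
  thus "tr (X' * ?W) \<noteq> 0" using tr0 nonsplit_params double[of u] by (simp add: two)
  have "?W \<noteq> sc e * X'" for e
  proof
    assume "?W = sc e * X'"
    hence "X * (X' * ?W) = sc e * (X * (X' * X'))" by (simp add: sc_left_commute)
    moreover have "X * (X' * ?W) = - sc v - sc u * X"
      unfolding X'W using sq by (simp add: right_diff_distrib sc_left_commute sc_commute)
    ultimately have "tr (- sc v - sc u * X) = tr (- (sc e * X))" using sq by simp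
    thus False using tr0 nonsplit_params by (simp add: two)
  qed
  from this[of 1] this[of "- 1"] show "?W \<noteq> X'" "?W \<noteq> - X'" by (simp_all add: sc_simps)
qed

text \<open>If different pairs had the same tests, each would pass the test of the other, so they
  would be orthogonal; the rotated \<open>W\<close> then lies in only one of the two test
  sets.\<close>

lemma involution_inj:
  assumes X: "X \<in> inv2" "X' \<in> inv2" and eq: "solvs X = solvs X'"
  shows "X = X' \<or> X = - X'"
proof (rule ccontr)
  assume ne: "\<not> (X = X' \<or> X = - X')"
  have T: "{X, - X} \<union> {Z \<in> inv2. tr (X * Z) = 0} = {X', - X'} \<union> {Z \<in> inv2. tr (X' * Z) = 0}"
    using nonsplit_tests_cong[OF eq] X by (simp add: nonsplit_tests_involution)
  hence "tr (X * X') = 0" using ne by auto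
  then obtain W where "W \<in> inv2" "tr (X * W) = 0" "tr (X' * W) \<noteq> 0" "W \<noteq> X'" "W \<noteq> - X'"
    using orthogonal_pair_rotation X by blast
  thus False using T by blast
qed

lemma nonsplit_inj:
  assumes "X \<in> inv2" "X' \<in> inv2" "solvs (tor u v X) = solvs (tor u v X')"
  shows "X = X' \<or> X = - X'"
  using nonsplit_tests_cong[OF assms(3)] assms(1,2) by (auto simp: nonsplit_tests_nonsplit doubleton_eq_iff)

lemma inv2_nonempty: "inv2 \<noteq> {}"
proof -
  have "M2 0 1 (- 1) 0 \<in> inv2" by (simp add: trace0_det_def)
  thus ?thesis by blast
qed

lemma nonsplit_tests_distinct:
  assumes X: "X \<in> inv2"
  shows "nonsplit_tests X \<noteq> inv2" "nonsplit_tests (tor u v X) \<noteq> inv2" "nonsplit_tests X \<noteq> {}"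
    "nonsplit_tests (tor u v X) \<noteq> {}" "X' \<in> inv2 \<Longrightarrow> nonsplit_tests X \<noteq> nonsplit_tests (tor u v X')"
proof -
  obtain Z where Z: "Z \<in> inv2" "tr (X * Z) = 0" using exists_orthogonal X by blast
  hence "tr (Z * X) = 0" using tr_commute by metis
  then obtain W where "W \<in> inv2" "tr (X * W) \<noteq> 0" "W \<noteq> X" "W \<noteq> - X"
    using orthogonal_pair_rotation[OF Z(1) X] by blast
  thus "nonsplit_tests X \<noteq> inv2" using X by (auto simp: nonsplit_tests_involution)
  have ZX: "Z \<noteq> X" "Z \<noteq> - X" using Z X tr_inv2_square[of X] by auto
  thus "nonsplit_tests (tor u v X) \<noteq> inv2" using X Z by (auto simp: nonsplit_tests_nonsplit)
  show "nonsplit_tests X \<noteq> {}" "nonsplit_tests (tor u v X) \<noteq> {}"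
    using X by (auto simp: nonsplit_tests_nonsplit nonsplit_tests_involution)
  assume X': "X' \<in> inv2"
  show "nonsplit_tests X \<noteq> nonsplit_tests (tor u v X')"
  proof
    assume "nonsplit_tests X = nonsplit_tests (tor u v X')"
    hence "{X, - X} \<union> {Z \<in> inv2. tr (X * Z) = 0} = {X', - X'}"
      using X X' by (simp add: nonsplit_tests_nonsplit nonsplit_tests_involution)
    hence "X = X' \<or> X = - X'" "Z = X' \<or> Z = - X'" using Z by blast+
    thus False using ZX by auto
  qed
qed

section \<open>Unipotents and split tori, told apart by fixed points\<close>

lemma nilp_square: "N \<in> nilp \<Longrightarrow> N * N = 0"
  using trace0_square[of N] by (auto simp: trace0_det_def sc_simps)

lemma spl_square: "X \<in> spl \<Longrightarrow> X * X = 1"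
  using trace0_square[of X] by (auto simp: trace0_det_def sc_simps)

text \<open>The unipotent fixes a single point of the projective line, represented by
  \<open>N\<close>. The question is whether the split torus of \<open>Z\<close> fixes it
  too.\<close>

lemma solv2_unipotent_split_iff:
  assumes N: "N \<in> nilp" and Z: "Z \<in> spl"
  shows "solv2 (tor 1 1 N) (tor p r Z) \<longleftrightarrow> tr (Z * N) = 0"
proof -
  have N0: "tr N = 0" "det N = 0" "N \<noteq> 0" using N by (auto simp: trace0_det_def)
  have tr_mult: "tr (tor 1 1 N * Y) = tr (N * Y)" if "tr Y = 0" for Y
    using that by (simp add: tor_def distrib_right sc_simps)
  have "N * Z \<noteq> Z * N"
  proof
    assume "N * Z = Z * N"
    then obtain c where "N = sc c * Z" "0 = c * c * - 1"
      using commuting_imp_same_line[of N 0 Z "- 1"] N Z spl_neq_0 by blast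
    thus False using N0 by (simp add: sc_simps)
  qed
  hence "solv2 (tor 1 1 N) (tor p r Z) \<longleftrightarrow>
      (\<exists>Y. Y \<noteq> 0 \<and> tr Y = 0 \<and> det Y = 0 \<and> tr (Z * Y) = 0 \<and> tr (N * Y) = 0)"
    using N0 det_tor(1)[OF N] by (auto simp: solv2_split_iff[OF Z] tor_commute_iff tr_tor tr_mult)
  also have "\<dots> \<longleftrightarrow> tr (Z * N) = 0"
  proof
    assume "\<exists>Y. Y \<noteq> 0 \<and> tr Y = 0 \<and> det Y = 0 \<and> tr (Z * Y) = 0 \<and> tr (N * Y) = 0"
    then obtain Y where Y: "Y \<noteq> 0" "tr Y = 0" "det Y = 0" "tr (Z * Y) = 0" "tr (N * Y) = 0" by blast
    then obtain c where "N = sc c * Y"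
      using isotropic_orthogonal_imp_proportional[of N Y] N0 two_neq_0 by auto
    thus "tr (Z * N) = 0" using Y by (simp add: sc_left_commute)
  next
    assume "tr (Z * N) = 0"
    thus "\<exists>Y. Y \<noteq> 0 \<and> tr Y = 0 \<and> det Y = 0 \<and> tr (Z * Y) = 0 \<and> tr (N * Y) = 0"
      using N0 nilp_square[OF N] by (intro exI[of _ N]) simp
  qed
  finally show ?thesis .
qed

lemma solv2_split_shared:
  assumes "X \<in> spl" "Z \<in> spl" and Y: "Y \<in> nilp" "tr (X * Y) = 0" "tr (Z * Y) = 0"
  shows "solv2 (tor p r X) (tor p r Z)"
proof -
  have "tr (tor p r X * Y) = 0"
    using Y by (simp add: tor_def distrib_right mult.assoc trace0_det_def)
  thus ?thesis
    using assms by (auto simp: solv2_split_iff det_tor trace0_det_def)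
qed

text \<open>\<open>Z\<close> is the commutator of \<open>N\<close> and \<open>N'\<close> scaled to
  square 1, and its torus fixes both points. Adding \<open>N\<close> keeps the point of
  \<open>N\<close> fixed but not that of \<open>N'\<close>.\<close>

lemma orthogonal_nilp_pair:
  assumes "N \<in> nilp" "N' \<in> nilp" "tr (N * N') \<noteq> 0"
  obtains Z where "Z \<in> spl" "Z + N \<in> spl" "tr (Z * N) = 0" "tr (Z * N') = 0" "tr ((Z + N) * N) = 0" "tr ((Z + N) * N') \<noteq> 0"
proof
  let ?p = "tr (N * N')"
  let ?V = "N * N' - N' * N"
  let ?Z = "sc (1 / ?p) * ?V"
  have N: "tr N = 0" "tr N' = 0" "N * N = 0" "N' * N' = 0"
    using assms nilp_square by (auto simp: trace0_det_def)
  have assoc: "N * (N * x) = 0" "N' * (N' * x) = 0" for x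
    using N by (simp_all add: mult.assoc[symmetric])
  have ac: "N' * N = sc ?p - N * N'"
    using trace0_anticommutator[of N N'] N by (simp add: algebra_simps)
  have "?V * ?V = N * (N' * N) * N' + N' * (N * N') * N"
    by (simp add: algebra_simps N assoc)
  also have "N' * (N * N') * N = (N' * N) * (N' * N)" by (simp add: mult.assoc)
  also have "\<dots> = sc ?p * (N' * N) - N * (N' * (N' * N))"
    by (subst (1) ac) (simp add: left_diff_distrib mult.assoc)
  also have "N * (N' * N) * N' = sc ?p * (N * N')"
    unfolding ac by (simp add: right_diff_distrib left_diff_distrib mult.assoc assoc sc_left_commute)
  finally have "?V * ?V = sc ?p * (N * N' + N' * N)"
    by (simp add: assoc distrib_left)
  also have "N * N' + N' * N = sc ?p" by (simp add: ac)
  finally have VV: "?V * ?V = sc ?p * sc ?p" .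
  have "?Z * ?Z = sc (1 / ?p) * sc (1 / ?p) * (?V * ?V)"
    by (simp only: mult.assoc sc_left_commute[of ?V])
  also have "\<dots> = sc (1 / ?p * (1 / ?p) * ?p * ?p)"
    unfolding VV by (simp only: sc_simps mult.assoc)
  finally have ZZ: "?Z * ?Z = 1" using assms(3) by (simp add: sc_simps(2))
  have "tr ?V = 0" by (simp add: tr_commute[of N N'])
  hence trZ: "tr ?Z = 0" by simp
  show ZN: "tr (?Z * N) = 0" "tr (?Z * N') = 0"
    using tr_commute[of N "N' * N"] tr_commute[of N' "N * N'"]
    by (simp_all add: mult.assoc left_diff_distrib N assoc)
  have spl_if_square: "X \<in> spl" if X: "tr X = 0" "X * X = 1" for X
  proof -
    have "sc (- det X) = sc 1" using trace0_square[OF X(1)] X(2) by (simp add: sc_simps)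
    hence "- det X = 1" by (simp only: sc_eq_iff)
    hence "det X = - 1" by (metis add.inverse_inverse)
    thus ?thesis using X by (simp add: trace0_det_def)
  qed
  show Z: "?Z \<in> spl" using spl_if_square trZ ZZ by blast
  have "?Z * N + N * ?Z = 0"
    using trace0_anticommutator[OF trZ N(1)] ZN by (simp add: sc_simps)
  hence "(?Z + N) * (?Z + N) = 1"
    using ZZ N by (simp add: distrib_left distrib_right add.commute add.left_commute)
  thus "?Z + N \<in> spl" using spl_if_square trZ N by simp
  show "tr ((?Z + N) * N) = 0" "tr ((?Z + N) * N') \<noteq> 0"
    using ZN N assms(3) by (simp_all add: distrib_right)
qed

text \<open>The partner is found in the plane spanned by \<open>N\<close> and its transpose
  \<open>M\<close>, which is isotropic too. They are not orthogonal: \<open>tr (N * M)\<close> is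
  the square of \<open>b - c\<close>, and \<open>b = c\<close> would make -1 a square.\<close>

lemma exists_tetrahedral_partner:
  assumes "N \<in> nilp" obtains y where "y \<in> inv2" "tr (N * y) = 1"
proof -
  obtain a b c where Nm: "N = M2 a b c (- a)"
    using assms by (cases N) (auto simp: trace0_det_def add_eq_0_iff)
  define M where "M = M2 a c b (- a)"
  have "- (a * a) - b * c = 0" using assms unfolding Nm trace0_det_def by auto
  hence abc: "a * a = - (b * c)" by (metis minus_minus eq_iff_diff_eq_0)
  hence M: "tr M = 0" "det M = 0" "tr (N * M) = 2 * (a * a) + b * b + c * c"
    by (simp_all add: M_def Nm mult.commute)
  have q: "tr (N * M) = (b - c) * (b - c)"
    unfolding M(3) abc by (simp add: algebra_simps)
  have "b \<noteq> c"
  proof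
    assume "b = c"
    hence e: "a * a = - (c * c)" using abc by simp
    show False
    proof (cases "c = 0")
      case True
      thus False using e \<open>b = c\<close> assms Nm by (simp add: m2_defs)
    next
      case False
      hence "a / c * (a / c) = - 1" using e by (simp add: field_simps)
      thus False using nonsquare by blast
    qed
  qed
  hence q0: "tr (N * M) \<noteq> 0" using q by simp
  let ?q = "tr (N * M)"
  \<comment> \<open>The coefficient of \<open>M\<close> is dictated by
    \<open>tr (N * ?y) = 1\<close>, and that of \<open>N\<close> then by
    \<open>?y * ?y = - 1\<close>.\<close>
  let ?y = "sc (1 / ?q) * M - N"
  have N: "tr N = 0" "N * N = 0" using assms nilp_square by (auto simp: trace0_det_def)
  have MM: "M * M = 0" using trace0_square[of M] M by (simp add: sc_simps)
  have "sc (1 / ?q) * M * (sc (1 / ?q) * M) = sc (1 / ?q * (1 / ?q)) * (M * M)"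
    by (rule sc_mult_mult)
  hence "?y * ?y = - (sc (1 / ?q) * M * N + N * (sc (1 / ?q) * M))"
    by (simp add: left_diff_distrib right_diff_distrib N MM)
  also have "N * (sc (1 / ?q) * M) = sc (1 / ?q) * (N * M)" by (rule sc_left_commute)
  finally have "?y * ?y = - (sc (1 / ?q) * (N * M + M * N))"
    by (simp add: distrib_left mult.assoc add.commute)
  also have "N * M + M * N = sc ?q"
    by (rule trace0_anticommutator[OF N(1) M(1)])
  also have "sc (1 / ?q) * sc ?q = sc (1 / ?q * ?q)"
    by (simp only: sc_simps)
  finally have "?y * ?y = - 1" using q0 by (simp add: sc_simps(2))
  moreover have tr_y: "tr ?y = 0" using M N by simp
  ultimately have "sc (det ?y) = sc 1"
    using trace0_square[OF tr_y] by (simp add: sc_simps)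
  hence "det ?y = 1" by (simp only: sc_eq_iff)
  moreover have "tr (N * ?y) = 1"
    using N q0 by (simp add: right_diff_distrib sc_left_commute)
  moreover from calculation(1) have "?y \<in> inv2"
    using tr_y by (simp only: trace0_det_def mem_Collect_eq simp_thms)
  ultimately show thesis using that by blast
qed

text \<open>Split tori detect the fixed point, so \<open>N' = c N\<close>. The scale is detected by
  an involution \<open>y\<close> generating \<open>A\<^sub>4\<close> with \<open>1 + N\<close>: a
  line shared by \<open>y\<close> and \<open>1 + N'\<close> would be that of \<open>N'\<close> and
  give \<open>c = 0\<close>, and otherwise \<open>c\<close>, the trace of \<open>(1 + N') y\<close>,
  lies in the prime field.\<close>

lemma unipotent_inj:
  assumes N: "N \<in> nilp" "N' \<in> nilp" and eq: "solvs (tor 1 1 N) = solvs (tor 1 1 N')"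
  shows "N = N' \<or> N = - N'"
proof -
  have N0: "tr N = 0" "det N = 0" "N \<noteq> 0" and N0': "tr N' = 0" "det N' = 0" "N' \<noteq> 0"
    using N by (auto simp: trace0_det_def)
  have iff: "tr (Z * N) = 0 \<longleftrightarrow> tr (Z * N') = 0" if "Z \<in> spl" for Z
    using solvs_eqD[OF eq det_tor(2)[OF that]] that N by (simp add: solv2_unipotent_split_iff)
  have "tr (N * N') = 0"
  proof (rule ccontr)
    assume "tr (N * N') \<noteq> 0"
    then obtain Z where "Z + N \<in> spl" "tr ((Z + N) * N) = 0" "tr ((Z + N) * N') \<noteq> 0"
      using orthogonal_nilp_pair[OF N] by metis
    thus False using iff by blast
  qed
  hence "tr (N' * N) = 0" using tr_commute by metis
  then obtain c where c: "N' = sc c * N"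
    using isotropic_orthogonal_imp_proportional[of N' N] N0 N0' two_neq_0 by auto
  have c0: "c \<noteq> 0" using c N0' by (auto simp: sc_simps)
  obtain y where y: "y \<in> inv2" "tr (N * y) = 1" using exists_tetrahedral_partner[OF N(1)] .
  have y0: "tr y = 0" "det y = 1" using y by (auto simp: trace0_det_def)
  have "solv2 (tor 1 1 N) y"
    using tetrahedral_imp_solv2[of N y] N0 y0 y(2) by (simp add: tor_def sc_simps)
  hence s: "solv2 (tor 1 1 N') y" using solvs_eqD[OF eq] y0 by simp
  have trN'y: "tr (N' * y) = c" using y c by (simp add: mult.assoc)
  have "c = 0 \<or> c = 1 \<or> c = - 1"
  proof (rule solv2_cases[OF s det_tor(1)[OF N(2)] y0(2)])
    fix Y assume Y: "tr Y = 0" "Y \<noteq> 0" "pres (tor 1 1 N') Y" "pres y Y"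
    have "\<exists>d. N' = sc d * Y"
    proof -
      have "tr (tor 1 1 N' * Y) = tr (N' * Y)"
        using Y by (simp add: tor_def distrib_right sc_simps)
      hence "N' * Y = Y * N' \<or> tr (N' * Y) = 0 \<and> det Y = 0"
        using Y(3) tr_tor[OF N0'(1), of 1 1] one_neq_zero
        unfolding pres_iff[OF Y(1,2) det_tor(1)[OF N(2)]] tor_commute_iff[OF one_neq_zero]
        by (metis neg_equal_0_iff_equal)
      thus ?thesis
        using commuting_trace0_imp_proportional[of N' Y] isotropic_orthogonal_imp_proportional[of N' Y]
          N0' Y two_neq_0 by blast
    qed
    hence "pres y N'" using pres_scale Y(4) by auto
    moreover have "y * N' \<noteq> N' * y"
    proof
      assume "y * N' = N' * y"
      then obtain e where "N' = sc e * y" "0 = e * e * 1"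
        using commuting_imp_same_line[of N' 0 y 1] N(2) y(1) inv2_neq_0 by (metis DiffD1)
      thus False using N0' by (simp add: sc_simps)
    qed
    ultimately have "tr (y * N') = 0" using N0' y0 by (simp add: pres_iff)
    thus ?thesis using trN'y tr_commute by metis
  next
    assume F3: "\<And>k. k = tor 1 1 N' \<or> k = y \<or> k = tor 1 1 N' * y \<Longrightarrow> tr k = 0 \<or> tr k = 1 \<or> tr k = - 1"
    have "tr (tor 1 1 N' * y) = c"
      using trN'y y0 by (simp add: tor_def distrib_right sc_simps)
    thus ?thesis using F3[of "tor 1 1 N' * y"] by simp
  qed
  thus ?thesis using c0 c by (auto simp: sc_simps)
qed

text \<open>The two isotropic lines correspond to the eigenlines of \<open>X\<close>, the fixed
  points of its torus.\<close>

lemma split_isotropic_pair: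
  assumes "X \<in> spl"
  obtains Y1 Y2 where "Y1 \<in> nilp" "Y2 \<in> nilp" "tr (X * Y1) = 0" "tr (X * Y2) = 0" "tr (Y1 * Y2) \<noteq> 0"
proof -
  obtain a b c where X: "X = M2 a b c (- a)"
    using assms by (cases X) (auto simp: trace0_det_def add_eq_0_iff)
  have "- (a * a) - b * c = - 1" using assms unfolding X trace0_det_def by auto
  hence abc: "b * c = 1 - a * a" by (simp add: algebra_simps)
  show thesis
  proof (cases "b = 0")
    case False
    \<comment> \<open>For \<open>e = 1\<close> and \<open>e = - 1\<close>, this is the nilpotent
      matrix whose image and kernel are spanned by the eigenvector \<open>(b, e - a)\<close> of
      \<open>X\<close>.\<close>
    define Y where "Y e = M2 (- b * (e - a)) (b * b) (- (e - a) * (e - a)) (b * (e - a))" for e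
    have nil: "Y e \<in> nilp" for e
      using False by (auto simp: Y_def trace0_det_def m2_defs algebra_simps)
    have "tr (X * Y e) = b * (b * c + a * a - e * e)" for e
      by (simp add: X Y_def algebra_simps)
    hence orth: "tr (X * Y e) = 0" if "e * e = 1" for e
      using that abc by simp
    have "tr (Y 1 * Y (- 1)) = - 4 * (b * b)"
      by (simp add: Y_def algebra_simps)
    hence "tr (Y 1 * Y (- 1)) \<noteq> 0" using False four by simp
    thus thesis using that nil orth by (metis mult_1 minus_mult_minus)
  next
    case True
    hence aa: "a * a = 1" using abc by simp
    \<comment> \<open>For \<open>b = 0\<close> the eigenvectors are \<open>(0, 1)\<close> and
      \<open>(2, a * c)\<close>.\<close>
    have "M2 0 0 1 0 \<in> nilp" "M2 (- 2 * a * c) 4 (- (c * c)) (2 * a * c) \<in> nilp"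
      using aa four by (simp_all add: trace0_det_def m2_defs algebra_simps)
    moreover have "tr (X * M2 0 0 1 0) = 0" using True X by simp
    moreover have "tr (X * M2 (- 2 * a * c) 4 (- (c * c)) (2 * a * c)) = 4 * c - 4 * (a * a) * c"
      using True X by (simp add: algebra_simps)
    moreover have "tr (M2 0 0 1 0 * M2 (- 2 * a * c) 4 (- (c * c)) (2 * a * c)) \<noteq> 0"
      using four by simp
    ultimately show thesis using that aa by (metis diff_self mult.right_neutral)
  qed
qed

text \<open>A matrix orthogonal to both anticommutes with each, so it commutes with their product
  and lies on the line of \<open>?V\<close>.\<close>

lemma orthogonal_to_isotropic_pair:
  assumes "Y1 \<in> nilp" "Y2 \<in> nilp" "tr (Y1 * Y2) \<noteq> 0"
    and "tr A = 0" "tr (A * Y1) = 0" "tr (A * Y2) = 0" and "tr B = 0" "tr (B * Y1) = 0" "tr (B * Y2) = 0"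
  shows "A * B = B * A"
proof -
  let ?V = "vec (Y1 * Y2)"
  have Y: "tr Y1 = 0" "tr Y2 = 0" "det Y1 = 0" using assms by (auto simp: trace0_det_def)
  have V0: "?V \<noteq> 0"
  proof
    assume "?V = 0"
    hence "tr (Y1 * Y2) * tr (Y1 * Y2) = 0" using det_vec[of "Y1 * Y2"] Y by simp
    thus False using assms(3) by simp
  qed
  have "\<exists>c. A = sc c * ?V" if A: "tr A = 0" "tr (A * Y1) = 0" "tr (A * Y2) = 0" for A
  proof -
    have anti: "A * Y1 = - (Y1 * A)" "A * Y2 = - (Y2 * A)"
      using trace0_anticommutator[of A Y1] trace0_anticommutator[of A Y2] A Y
      by (simp_all add: sc_simps eq_neg_iff_add_eq_0)
    have "A * (Y1 * Y2) = A * Y1 * Y2" by (simp add: mult.assoc)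
    also have "\<dots> = - (Y1 * (A * Y2))" by (simp add: anti(1) mult.assoc)
    also have "\<dots> = Y1 * Y2 * A" by (simp add: anti(2) mult.assoc)
    finally have "A * (Y1 * Y2) = Y1 * Y2 * A" .
    hence "A * ?V = ?V * A" using vec_commute_iff by metis
    thus ?thesis using commuting_trace0_imp_proportional[of A ?V] A V0 two_neq_0 by auto
  qed
  then obtain c d where cd: "A = sc c * ?V" "B = sc d * ?V" using assms by meson
  show ?thesis unfolding cd by (cases ?V) (simp add: m2_defs algebra_simps)
qed

text \<open>Unipotent tests recover the two fixed points of the torus, and these determine
  \<open>X\<close> up to sign.\<close>

lemma split_inj:
  assumes X: "X \<in> spl" "X' \<in> spl" and eq: "solvs (tor p r X) = solvs (tor p r X')"
  shows "X = X' \<or> X = - X'"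
proof -
  obtain Y1 Y2 where Y: "Y1 \<in> nilp" "Y2 \<in> nilp" "tr (X * Y1) = 0" "tr (X * Y2) = 0" "tr (Y1 * Y2) \<noteq> 0"
    using split_isotropic_pair[OF X(1)] .
  have "tr (X * N) = 0 \<longleftrightarrow> tr (X' * N) = 0" if "N \<in> nilp" for N
    using solvs_eqD[OF eq det_tor(1)[OF that]] that X
    by (simp add: solv2_commute[of "tor p r _"] solv2_unipotent_split_iff)
  hence "X * X' = X' * X"
    using orthogonal_to_isotropic_pair[OF Y(1,2,5)] Y X by (simp add: trace0_det_def)
  thus ?thesis using trace0_det_scale_eq[OF X] by simp
qed

text \<open>One of the two fixed points of the torus, given by \<open>Y\<close>, differs from that
  of \<open>N\<close>. The split tori of \<open>X\<close> and \<open>X + Y\<close> both fix it, so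
  both pass the test of \<open>X\<close>. If they passed that of \<open>N\<close>, then
  \<open>N\<close> would be orthogonal to \<open>X\<close> and \<open>X + Y\<close>, hence to
  \<open>Y\<close>.\<close>

lemma unipotent_neq_split:
  assumes N: "N \<in> nilp" and X: "X \<in> spl"
  shows "solvs (tor 1 1 N) \<noteq> solvs (tor p r X)"
proof
  assume eq: "solvs (tor 1 1 N) = solvs (tor p r X)"
  obtain Y1 Y2 where Y: "Y1 \<in> nilp" "Y2 \<in> nilp" "tr (X * Y1) = 0" "tr (X * Y2) = 0" "tr (Y1 * Y2) \<noteq> 0"
    using split_isotropic_pair[OF X(1)] .
  have "\<not> (tr (N * Y1) = 0 \<and> tr (N * Y2) = 0)"
  proof
    assume "tr (N * Y1) = 0 \<and> tr (N * Y2) = 0"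
    hence "N * X = X * N"
      using orthogonal_to_isotropic_pair[OF Y(1,2,5)] Y X N by (simp add: trace0_det_def)
    then obtain c where "N = sc c * X" "0 = c * c * - 1"
      using commuting_imp_same_line[of N 0 X "- 1"] N X spl_neq_0 by blast
    thus False using N by (simp add: sc_simps)
  qed
  then obtain Y where Y: "Y \<in> nilp" "tr (X * Y) = 0" "tr (N * Y) \<noteq> 0" using Y by blast
  have tr0: "tr X = 0" "tr Y = 0" using X Y by (auto simp: trace0_det_def)
  have XY: "X * Y + Y * X = 0"
    using trace0_anticommutator[of X Y] tr0 Y by (simp add: sc_simps)
  have YY: "Y * Y = 0" and XX: "X * X = 1" using Y X nilp_square spl_square by auto
  let ?Z = "X + Y"
  have "?Z * ?Z = 1"
    using XX YY XY by (simp add: distrib_left distrib_right add.commute add.left_commute)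
  hence "sc (- det ?Z) = sc 1" using trace0_square[of ?Z] tr0 by (simp add: sc_simps)
  hence "- det ?Z = 1" by (simp only: sc_eq_iff)
  hence "det ?Z = - 1" by (metis add.inverse_inverse)
  hence Z: "?Z \<in> spl" using tr0 by (simp add: trace0_det_def)
  have "tr (?Z * Y) = 0" using Y YY by (simp add: distrib_right)
  hence "solv2 (tor p r X) (tor p r X)" "solv2 (tor p r X) (tor p r ?Z)"
    using solv2_split_shared X Z Y by blast+
  hence "solv2 (tor 1 1 N) (tor p r X)" "solv2 (tor 1 1 N) (tor p r ?Z)"
    using solvs_eqD[OF eq] det_tor X Z by blast+
  hence "tr (X * N) = 0" "tr (?Z * N) = 0"
    using N X Z by (simp_all only: solv2_unipotent_split_iff)
  thus False using Y tr_commute[of N Y] by (simp add: distrib_right)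
qed

subsection \<open>Counting\<close>

lemma solvs_minus: "solvs (- g) = solvs g"
  by (simp add: solvs_def solv2_minus)

lemma solvs_adj: "det g = 1 \<Longrightarrow> solvs (adj g) = solvs g"
  by (auto simp: solvs_def solv2_adj)

lemma adj_tor: "tr X = 0 \<Longrightarrow> adj (tor a b X) = tor a b (- X :: 'a m2)"
  by (cases X) (simp add: adj_def tor_def m2_defs add_eq_0_iff)

lemma solvs_tor_minus:
  assumes "tr X = 0" "det (tor a b X) = 1"
  shows "solvs (tor a b (- X)) = solvs (tor a b X)"
  using solvs_adj[OF assms(2)] adj_tor[OF assms(1)] by simp

lemma unipotent_eq_iff:
  assumes "N \<in> nilp" "N' \<in> nilp"
  shows "solvs (tor 1 1 N) = solvs (tor 1 1 N') \<longleftrightarrow> N = N' \<or> N = - N'"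
proof -
  have "solvs (tor 1 1 (- N')) = solvs (tor 1 1 N')"
    using assms(2) det_tor(1) by (intro solvs_tor_minus) (auto simp: trace0_det_def)
  thus ?thesis using unipotent_inj[OF assms] by metis
qed

lemma split_eq_iff:
  assumes "X \<in> spl" "X' \<in> spl"
  shows "solvs (tor p r X) = solvs (tor p r X') \<longleftrightarrow> X = X' \<or> X = - X'"
proof -
  have "solvs (tor p r (- X')) = solvs (tor p r X')"
    using assms(2) det_tor(2) by (intro solvs_tor_minus) (auto simp: trace0_det_def)
  thus ?thesis using split_inj[OF assms] by metis
qed

lemma nonsplit_eq_iff:
  assumes "X \<in> inv2" "X' \<in> inv2"
  shows "solvs (tor u v X) = solvs (tor u v X') \<longleftrightarrow> X = X' \<or> X = - X'"
proof -
  have "solvs (tor u v (- X')) = solvs (tor u v X')"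
    using assms(2) det_tor(3) by (intro solvs_tor_minus) (auto simp: trace0_det_def)
  thus ?thesis using nonsplit_inj[OF assms] by metis
qed

lemma involution_eq_iff:
  assumes "X \<in> inv2" "X' \<in> inv2"
  shows "solvs X = solvs X' \<longleftrightarrow> X = X' \<or> X = - X'"
  using involution_inj[OF assms] solvs_minus[of X'] by metis

text \<open>Every fibre is a pair \<open>y\<close>, \<open>- y\<close>, of size two because
  \<open>y = - y\<close> forces \<open>y = 0\<close>.\<close>

lemma card_image_two_to_one:
  fixes f :: "'a m2 \<Rightarrow> 'b"
  assumes S: "\<And>x. x \<in> S \<Longrightarrow> - x \<in> S" "0 \<notin> S"
    and f: "\<And>x y. x \<in> S \<Longrightarrow> y \<in> S \<Longrightarrow> f x = f y \<longleftrightarrow> x = y \<or> x = - y"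
    and fin: "finite S"
  shows "2 * card (f ` S) = card S"
proof -
  have "card S = (\<Sum>z\<in>f ` S. card {x \<in> S. f x = z})"
    using sum.image_gen[OF fin, of "\<lambda>_. 1" f] by (simp only: card_eq_sum)
  also have "\<dots> = (\<Sum>z\<in>f ` S. 2)"
  proof (rule sum.cong[OF refl], clarify)
    fix y assume y: "y \<in> S"
    have "{x \<in> S. f x = f y} = {y, - y}" using S f y by auto
    moreover have "y \<noteq> - y"
    proof
      assume "y = - y"
      hence "y = 0" using m2_double[of y] by simp
      thus False using S y by simp
    qed
    ultimately show "card {x \<in> S. f x = f y} = 2" by simp
  qed
  finally show ?thesis by simp
qed

text \<open>The cases follow the trace \<open>t\<close>, as \<open>det (vec g) = 1 - t * t\<close>.
  Trace 1 is reduced to trace -1 by passing to \<open>- g\<close>. For \<open>t\<close> outside the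
  prime field, \<open>vec g\<close> is scaled to determinant 1 or -1.\<close>

lemma solvs_covering:
  "solvs ` {g. det g = 1} = {solvs 1} \<union> (\<lambda>N. solvs (tor 1 1 N)) ` nilp \<union> (\<lambda>X. solvs (tor p r X)) ` spl
     \<union> (\<lambda>X. solvs (tor u v X)) ` inv2 \<union> solvs ` inv2" (is "_ = ?R")
proof (intro subset_antisym subsetI)
  fix S assume "S \<in> solvs ` {g. det g = 1}"
  then obtain g where g: "S = solvs g" "det g = 1" by auto
  let ?X = "vec g" and ?t = "tr g"
  have dX: "det ?X = 1 - ?t * ?t" using det_vec g by simp
  have pm: "solvs g = solvs (tor 1 1 ?X)" if "?t = - 1"
    using eq_vec[of g] that by (simp add: tor_def sc_simps add.commute)
  have pm': "solvs g = solvs (tor 1 1 (- ?X))" if "?t = 1"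
  proof -
    have "g = - tor 1 1 (- ?X)"
      using eq_vec[of g] that by (simp add: tor_def sc_simps)
    thus ?thesis using solvs_minus by metis
  qed
  consider "?t = 1 \<or> ?t = - 1" "?X = 0" | "?t = - 1" "?X \<noteq> 0" | "?t = 1" "?X \<noteq> 0" | "?t = 0"
    | "?t \<noteq> 0" "?t \<noteq> 1" "?t \<noteq> - 1" by blast
  thus "S \<in> ?R"
  proof cases
    case 1
    hence "S = solvs 1" using g pm pm' by (auto simp: tor_def sc_simps)
    thus ?thesis by blast
  next
    case 2
    hence "?X \<in> nilp" using dX by (simp add: trace0_det_def)
    thus ?thesis using g pm 2 by blast
  next
    case 3
    hence "- ?X \<in> nilp" using dX by (simp add: trace0_det_def)
    thus ?thesis using g pm' 3 by blast
  next
    case 4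
    hence "g \<in> inv2" using g by (simp add: trace0_det_def)
    thus ?thesis using g by blast
  next
    case 5
    hence d0: "det ?X \<noteq> 0" using dX by (simp add: square_eq_1_iff)
    obtain s where s: "det ?X = s * s \<or> det ?X = - (s * s)" using square_or_minus by blast
    have s0: "s \<noteq> 0" using s d0 by auto
    define Y where "Y = sc (1 / s) * ?X"
    have Y: "tr Y = 0" by (simp add: Y_def)
    \<comment> \<open>By \<open>solv2_proportional\<close>, any admissible parameters give the same
      solvabilizer, in particular the fixed ones.\<close>
    have same: "solvs g = solvs (tor a b Y)"
      if ab: "a \<noteq> 0" "b \<noteq> 0" "a * a + b * b * det Y = 1" for a b
    proof -
      have det: "det (tor a b Y) = 1" using ab Y by (simp add: tor_def det_sc_add)
      have "det Y \<noteq> 0" using d0 s0 by (simp add: Y_def)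
      hence "a * a \<noteq> 1" using ab by auto
      hence "- a \<noteq> 1" "- a \<noteq> - 1" by (metis minus_mult_minus mult_1, auto)
      moreover have "vec (tor a b Y) = sc (b * (1 / s)) * vec g"
        unfolding vec_tor[OF Y] by (simp only: Y_def sc_simps(6) mult.assoc)
      ultimately have "solv2 (tor a b Y) h \<longleftrightarrow> solv2 g h" if "det h = 1" for h
        using that 5 ab(1,2) s0 g(2) det
        by (intro solv2_proportional[where c = "b * (1 / s)"]) (simp_all add: tr_tor Y)
      thus ?thesis by (auto simp: solvs_def)
    qed
    from s show ?thesis
    proof
      assume "det ?X = s * s"
      hence det: "det Y = 1" using s0 by (simp add: Y_def)
      hence "solvs g = solvs (tor u v Y)" using same nonsplit_params by simp
      moreover have "Y \<in> inv2" using det Y by (simp add: trace0_det_def)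
      ultimately show ?thesis using g by blast
    next
      assume "det ?X = - (s * s)"
      hence det: "det Y = - 1" using s0 by (simp add: Y_def)
      hence "solvs g = solvs (tor p r Y)" using same split_params by simp
      moreover have "Y \<in> spl" using det Y by (simp add: trace0_det_def)
      ultimately show ?thesis using g by blast
    qed
  qed
next
  fix S assume "S \<in> ?R"
  moreover have "solvs g \<in> solvs ` {g. det g = 1}" if "det g = 1" for g
    using that by blast
  moreover have "det X = 1" if "X \<in> inv2" for X
    using that by (simp add: trace0_det_def)
  ultimately show "S \<in> solvs ` {g. det g = 1}"
    using det_tor det_simps(2) by (elim UnE imageE insertE emptyE) (simp_all only:)
qed

text \<open>The points of \<open>- (a * a) - b * c = e\<close> are counted by \<open>b\<close>: if
  \<open>b \<noteq> 0\<close>, then \<open>c\<close> is determined by \<open>a\<close> and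
  \<open>b\<close>; if \<open>b = 0\<close>, then \<open>c\<close> is free.\<close>

lemma card_trace0_det:
  "finite (trace0_det (e::'a))"
  "card (trace0_det (e::'a)) = card (UNIV :: 'a set) * (card (UNIV :: 'a set) - 1) + card (UNIV :: 'a set) * card {a::'a. - (a * a) = e}"
proof -
  let ?f = "\<lambda>(a::'a, b). M2 a b ((- e - a * a) / b) (- a)" and ?g = "\<lambda>(a::'a, c). M2 a 0 c (- a)"
  let ?A = "(UNIV :: 'a set) \<times> (UNIV - {0::'a})" and ?B = "{a::'a. - (a * a) = e} \<times> (UNIV :: 'a set)"
  have eq: "trace0_det e = ?f ` ?A \<union> ?g ` ?B"
  proof (intro subset_antisym subsetI)
    fix X assume X: "X \<in> trace0_det e"
    then obtain a b c where abc: "X = M2 a b c (- a)"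
      by (cases X) (auto simp: trace0_det_def add_eq_0_iff)
    have e: "- (a * a) - b * c = e" using X unfolding abc trace0_det_def by auto
    show "X \<in> ?f ` ?A \<union> ?g ` ?B"
    proof (cases "b = 0")
      case True
      hence "X = ?g (a, c)" "(a, c) \<in> ?B" using abc e by auto
      thus ?thesis by blast
    next
      case False
      have "c * b = - e - a * a" unfolding e[symmetric] by (simp add: algebra_simps)
      hence "c = (- e - a * a) / b" using False by (simp add: eq_divide_eq)
      hence "X = ?f (a, b)" "(a, b) \<in> ?A" using abc False by auto
      thus ?thesis by blast
    qed
  next
    fix X assume "X \<in> ?f ` ?A \<union> ?g ` ?B"
    thus "X \<in> trace0_det e" by (auto simp: trace0_det_def)
  qed
  show "finite (trace0_det e)" unfolding eq by (intro finite_UnI finite_imageI) simp_all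
  have "inj_on ?f ?A" "inj_on ?g ?B" by (auto simp: inj_on_def)
  moreover have "?f ` ?A \<inter> ?g ` ?B = {}" by auto
  ultimately have "card (trace0_det e) = card ?A + card ?B"
    unfolding eq by (subst card_Un_disjoint) (simp_all only: card_image finite_imageI finite finite_cartesian_product)
  thus "card (trace0_det e) = card (UNIV :: 'a set) * (card (UNIV :: 'a set) - 1) + card (UNIV :: 'a set) * card {a::'a. - (a * a) = e}"
    by (simp only: card_cartesian_product mult.commute) (simp add: card_Diff_singleton mult.commute)
qed

lemma card_solvs:
  "2 * card (solvs ` {g. det g = 1}) = 4 * (card (UNIV :: 'a set))\<^sup>2 - card (UNIV :: 'a set) + 1"
proof -
  let ?q = "card (UNIV :: 'a set)"
  have q: "?q > 0" by (simp add: card_gt_0_iff)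
  have one: "(1::'a) \<noteq> - 1" using eq_minus_iff_0[of 1] by simp
  have "{a::'a. - (a * a) = 1} = {}"
    using nonsquare by (metis (mono_tags, lifting) Collect_empty_eq add.inverse_inverse)
  hence ci: "card inv2 = ?q * (?q - 1)" using card_trace0_det(2)[of 1] by simp
  have "{a::'a. - (a * a) = - 1} = {1, - 1}" by (auto simp: square_eq_1_iff)
  hence cs: "card spl = ?q * (?q - 1) + ?q * 2"
    using card_trace0_det(2)[of "- 1"] one by simp
  have "{a::'a. - (a * a) = 0} = {0}" by auto
  moreover have "0 \<in> trace0_det (0::'a)" by (simp add: trace0_det_def)
  ultimately have cn: "card nilp = ?q * (?q - 1) + ?q - 1"
    using card_trace0_det[of 0] by (simp add: card_Diff_singleton)
  let ?F0 = "{solvs 1}" and ?F1 = "(\<lambda>N. solvs (tor 1 1 N)) ` nilp" and ?F2 = "(\<lambda>X. solvs (tor p r X)) ` spl"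
    and ?F3 = "(\<lambda>X. solvs (tor u v X)) ` inv2" and ?F4 = "solvs ` inv2"
  note fin = card_trace0_det(1)
  note tests = nonsplit_tests_one nonsplit_tests_unipotent nonsplit_tests_split inv2_nonempty
    nonsplit_tests_distinct
  have T: "nonsplit_tests g \<noteq> nonsplit_tests g' \<Longrightarrow> solvs g \<noteq> solvs g'" for g g'
    using nonsplit_tests_cong by blast
  have "solvs 1 \<noteq> solvs (tor 1 1 N)" if "N \<in> nilp" for N
    by (rule T) (use that tests(1,2,4) in simp)
  hence d01: "?F0 \<inter> ?F1 = {}" by blast
  have "solvs 1 \<noteq> solvs (tor p r X)" if "X \<in> spl" for X
    by (rule T) (use that tests(1,3,4) in simp)
  hence d02: "?F0 \<inter> ?F2 = {}" by blast
  have "solvs 1 \<noteq> solvs (tor u v X)" "solvs 1 \<noteq> solvs X" if "X \<in> inv2" for X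
    by (rule T, use that tests(1,5,6) in metis)+
  hence d03: "?F0 \<inter> ?F3 = {}" "?F0 \<inter> ?F4 = {}" by blast+
  have d12: "?F1 \<inter> ?F2 = {}" using unipotent_neq_split by blast
  have "solvs (tor 1 1 N) \<noteq> solvs (tor u v X)" "solvs (tor 1 1 N) \<noteq> solvs X"
    if "N \<in> nilp" "X \<in> inv2" for X N
    by (rule T, use that tests(2,7,8) in metis)+
  hence d13: "?F1 \<inter> ?F3 = {}" "?F1 \<inter> ?F4 = {}" by blast+
  have "solvs (tor p r Z) \<noteq> solvs (tor u v X)" "solvs (tor p r Z) \<noteq> solvs X"
    if "Z \<in> spl" "X \<in> inv2" for X Z
    by (rule T, use that tests(3,7,8) in metis)+
  hence d23: "?F2 \<inter> ?F3 = {}" "?F2 \<inter> ?F4 = {}" by blast+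
  have "solvs (tor u v X') \<noteq> solvs X" if "X \<in> inv2" "X' \<in> inv2" for X X'
    by (rule T) (use that tests(9) in metis)
  hence d34: "?F3 \<inter> ?F4 = {}" by blast
  have disj: "?F0 \<inter> ?F1 = {}" "(?F0 \<union> ?F1) \<inter> ?F2 = {}" "(?F0 \<union> ?F1 \<union> ?F2) \<inter> ?F3 = {}"
    "(?F0 \<union> ?F1 \<union> ?F2 \<union> ?F3) \<inter> ?F4 = {}"
    by (simp_all only: Int_Un_distrib2 d01 d02 d03 d12 d13 d23 d34 Un_empty)
  have neg: "- X \<in> trace0_det e" if "X \<in> trace0_det e" for X and e :: 'a
    using that by (simp add: trace0_det_def)
  have n0: "0 \<notin> spl" "0 \<notin> inv2" by (simp_all add: trace0_det_def)
  have "2 * card ?F1 = card nilp"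
    by (rule card_image_two_to_one) (use neg fin unipotent_eq_iff in auto)
  moreover have "2 * card ?F2 = card spl"
    by (rule card_image_two_to_one) (use neg fin split_eq_iff n0 in auto)
  moreover have "2 * card ?F3 = card inv2"
    by (rule card_image_two_to_one) (use neg fin nonsplit_eq_iff n0 in auto)
  moreover have "2 * card ?F4 = card inv2"
    by (rule card_image_two_to_one) (use neg fin involution_eq_iff n0 in auto)
  moreover have "card (solvs ` {g. det g = 1}) = 1 + card ?F1 + card ?F2 + card ?F3 + card ?F4"
  proof -
    have "finite ?F1" "finite ?F2" "finite ?F3" "finite ?F4" using fin by simp_all
    thus ?thesis unfolding solvs_covering
      using disj by (simp only: card_Un_disjoint finite_Un finite.intros simp_thms) simp
  qed
  ultimately have "2 * card (solvs ` {g. det g = 1}) = 2 + card nilp + card spl + 2 * card inv2"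
    by linarith
  \<comment> \<open>The summand 2 is twice the class of the identity. Writing \<open>?q\<close> as a
    successor removes the truncated subtraction.\<close>
  also have "\<dots> = 4 * ?q\<^sup>2 - ?q + 1"
  proof -
    obtain k where "?q = Suc k" using q by (cases ?q) auto
    thus ?thesis unfolding ci cs cn by (simp add: power2_eq_square algebra_simps)
  qed
  finally show ?thesis .
qed

lemma card_Solv: "card (Solv (PSL2 :: ('a \<times> 'a \<times> 'a \<times> 'a) set monoid)) = card (solvs ` {g. det g = 1})"
proof -
  have "Sol PSL2 (proj g) = proj ` solvs g" for g :: "'a m2"
    by (auto simp: Sol_def solvs_def solv2_def carrier_PSL2)
  hence "Solv (PSL2 :: ('a \<times> 'a \<times> 'a \<times> 'a) set monoid) = (`) proj ` solvs ` {g. det g = 1}"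
    by (simp add: Solv_def carrier_PSL2 image_image)
  moreover have "inj_on ((`) proj) (solvs ` {g. det g = 1})"
  proof (rule inj_onI)
    \<comment> \<open>Solvabilizers are closed under sign change, so each is the full preimage of
      its image in \<open>PSL2\<close>.\<close>
    have key: "solvs g = {h. det h = 1 \<and> proj h \<in> proj ` solvs g}" for g
      by (auto simp: solvs_def proj_eq_iff solv2_commute[of g] solv2_minus)
    fix S S' assume "S \<in> solvs ` {g. det g = 1}" "S' \<in> solvs ` {g. det g = 1}" and eq: "proj ` S = proj ` S'"
    then obtain g g' where g: "S = solvs g" "S' = solvs g'" by blast
    show "S = S'"
      unfolding g by (subst (1 2) key) (use eq g in simp)
  qed
  ultimately show ?thesis by (simp add: card_image)
qed

end

section \<open>Arithmetic of the finite field\<close>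

lemma finite_field_power_card:
  fixes x :: "'a::{field,finite}"
  shows "x ^ card (UNIV :: 'a set) = x"
proof (cases "x = 0")
  case False
  \<comment> \<open>Multiplication by \<open>x\<close> permutes the nonzero elements.\<close>
  have "(\<Prod>y\<in>UNIV - {0}. x * y) = (\<Prod>y\<in>UNIV - {0}. y)"
    by (rule prod.reindex_bij_witness[of _ "\<lambda>y. y / x" "\<lambda>y. x * y"]) (use False in auto)
  hence "x ^ (card (UNIV :: 'a set) - 1) * \<Prod>(UNIV - {0}) = \<Prod>(UNIV - {0})"
    by (simp add: prod.distrib)
  moreover have "\<Prod>(UNIV - {0::'a}) \<noteq> 0" by simp
  ultimately have "x ^ (card (UNIV :: 'a set) - 1) = 1" by simp
  hence "x * x ^ (card (UNIV :: 'a set) - 1) = x" by simp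
  thus ?thesis by (metis power_Suc Suc_diff_1 finite_UNIV_card_ge_0 finite)
qed (simp add: card_gt_0_iff)

text \<open>For odd \<open>n\<close>, \<open>3 ^ n\<close> is 3 modulo 8, so nonzero elements
  satisfy \<open>x ^ (8 * k + 2) = 1\<close>. Half of this exponent is odd, so -1 is not a
  square.\<close>

lemma char3_field_if_card:
  assumes "odd n" and "n \<ge> 3" and card: "card (UNIV :: 'a::{field,finite} set) = 3 ^ n"
  shows "char3_field TYPE('a)"
proof -
  have "CHAR('a) dvd 3 ^ n" using CHAR_dvd_CARD[where ?'a = 'a] card by simp
  moreover have pr: "prime CHAR('a)"
    using prime_CHAR_semidom[where ?'a = 'a] finite_imp_CHAR_pos[where ?'a = 'a] by simp
  ultimately have "CHAR('a) dvd 3" using prime_dvd_power by blast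
  hence char: "CHAR('a) = 3" using pr by (simp add: primes_dvd_imp_eq)
  have three: "(3::'a) = 0" using of_nat_CHAR[where ?'a = 'a] char by simp
  obtain m where m: "n = 2 * m + 1" using assms(1) by (elim oddE)
  have "(9::nat) ^ m mod 8 = 1" by (induction m) (simp_all add: mod_mult_eq[symmetric, of 9])
  hence "(3::nat) ^ n mod 8 = 3" using m by (simp add: power_mult mod_mult_right_eq[symmetric, of 3])
  then obtain k where k: "3 ^ n = 8 * k + (3::nat)" by (metis mult_div_mod_eq)
  have fermat: "x ^ (8 * k + 2) = 1" if "x \<noteq> 0" for x :: 'a
  proof -
    have "x ^ (8 * k + 3) = x" using finite_field_power_card[of x] card k by simp
    hence "x * x ^ (8 * k + 2) = x" by (simp add: numeral_3_eq_3 numeral_2_eq_2)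
    thus ?thesis using that by simp
  qed
  have one: "(1::'a) \<noteq> - 1"
  proof
    assume "(1::'a) = - 1"
    hence "(2::'a) = 0" by (simp add: eq_neg_iff_add_eq_0)
    moreover have "(3::'a) = 2 + 1" by simp
    ultimately show False using three by simp
  qed
  show ?thesis
  proof
    show "(3::'a) = 0" by (rule three)
  next
    fix x :: 'a
    show "x * x \<noteq> - 1"
    proof
      assume x: "x * x = - 1"
      have "x ^ (8 * k + 2) = (x * x) ^ (4 * k + 1)"
        by (simp add: power_mult[symmetric] power2_eq_square[symmetric])
      hence "x ^ (8 * k + 2) = - 1" unfolding x by (simp add: power_mult)
      moreover have "x \<noteq> 0" using x by auto
      ultimately show False using fermat[of x] one by simp
    qed
  next
    fix x :: 'a
    show "\<exists>s. x = s * s \<or> x = - (s * s)"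
    proof (cases "x = 0")
      case False
      \<comment> \<open>As in Euler's criterion, this power is 1 or -1, and accordingly
        \<open>x ^ (2 * k + 1)\<close> is a square root of \<open>x\<close> or of
        \<open>- x\<close>.\<close>
      have "x ^ (4 * k + 1) * x ^ (4 * k + 1) = 1"
        using fermat[OF False] by (simp add: power_add[symmetric] algebra_simps)
      hence "x ^ (4 * k + 1) = 1 \<or> x ^ (4 * k + 1) = - 1" by (simp add: square_eq_1_iff)
      moreover have "x ^ (2 * k + 1) * x ^ (2 * k + 1) = x * x ^ (4 * k + 1)"
        by (simp add: power_add[symmetric] algebra_simps)
      ultimately show ?thesis by (metis minus_minus mult_1_right mult_minus1_right)
    qed (auto intro: exI[of _ 0])
  next
    show "\<exists>m::'a. m \<noteq> 0 \<and> m \<noteq> 1 \<and> m \<noteq> - 1"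
    proof (rule ccontr)
      assume "\<not> (\<exists>m::'a. m \<noteq> 0 \<and> m \<noteq> 1 \<and> m \<noteq> - 1)"
      hence "(UNIV :: 'a set) \<subseteq> {0, 1, - 1}" by blast
      hence "card (UNIV :: 'a set) \<le> card {0, 1, - 1 :: 'a}" by (intro card_mono) auto
      also have "\<dots> \<le> 3" by (simp add: card_insert_if)
      finally have "(3::nat) ^ n \<le> 3 ^ 1" using card by simp
      moreover have "(3::nat) ^ 1 < 3 ^ n"
        using assms(2) by (intro power_strict_increasing) auto
      ultimately show False by simp
    qed
  qed
qed

theorem theorem4p3:
  fixes n :: nat
  assumes "odd n" and "n \<ge> 3"
    and "card (UNIV :: 'a set) = 3 ^ n"
  shows "card (Solv (PSL2 :: ('a::{field,finite} \<times> 'a \<times> 'a \<times> 'a) set monoid))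
           = (4 * (3 ^ n)\<^sup>2 - 3 ^ n + 1) div 2"
proof -
  interpret char3_field "TYPE('a)" using assms by (rule char3_field_if_card)
  obtain p r u v :: 'a where "p \<noteq> 0" "r \<noteq> 0" "p * p - r * r = 1" "u \<noteq> 0" "v \<noteq> 0" "u * u + v * v = 1"
    using exists_split_params exists_nonsplit_params by blast
  then interpret char3_tori "TYPE('a)" p r u v by unfold_locales
  \<comment> \<open>\<open>card_solvs\<close> counts twice the solvabilizers, so the division by 2
    is exact.\<close>
  show ?thesis
    using card_solvs card_Solv assms(3) by simp
qed

end
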